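(* Let $n \geq 1$ be an integer and $p = (n+1)/n$. Let $f \in L^1(\mathbb R^n)$ be a complex-valued function satisfying $$\mathrm{Re}\, f(x) = 0 \quad \text{and} \quad -\mathrm{Im}\, f(x) > 0 \quad \text{for any } x \in \mathbb R^n.$$ Then there exist constants $\varepsilon_0 > 0$ and $C = C(n,p,f) > 0$, with $C$ independent of $\varepsilon$, such that for every $\varepsilon \in (0,\varepsilon_0)$ there are no global weak solutions to $$i \partial_t u + (-\Delta)^{1/2} u = |u|^p, \qquad u(0) = \varepsilon f,$$ and the maximal existence time $T_m = T_m(\varepsilon f)$ satisfies $$T_m \leq \exp(C \varepsilon^{-1/n}).$$
   Context: The fractional Laplacian $(-\Delta)^{1/2}$ on $\mathbb R^n$ is the Fourier multiplier with symbol $|\xi|$, i.e. $(-\Delta)^{1/2} = \mathcal F^{-1} |\xi| \mathcal F$, where $\mathcal F$ is the Fourier transform; applied to a function of $(t,x) \in \mathbb R \times \mathbb R^n$ it acts in the variable $x$ only. Consider the Cauchy problem $$i \partial_t u + (-\Delta)^{1/2} u = |u|^p, \quad t \in [0,T),\ x \in \mathbb R^n, \qquad u(0) = u_0,$$ for complex-valued $u$, with $p>1$. Weak solution: for $T>0$ and initial data $u_0 \in L^1(\mathbb R^n)$, $u$ is a weak solution on $[0,T)$ if $u \in L^1_{\mathrm{loc}}(0,T;L^2(\mathbb R^n)) \cap L^1_{\mathrm{loc}}(0,T;L^p(\mathbb R^n))$ and the identity $$\int_0^\infty \int_{\mathbb R^n} u(t,x)\, \overline{(i\partial_t + (-\Delta)^{1/2})\phi(t,x)}\,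 dx\, dt = i \int_{\mathbb R^n} u_0(x)\, \overline{\phi(0,x)}\, dx + \int_0^\infty \int_{\mathbb R^n} |u(t,x)|^p\, \overline{\phi(t,x)}\, dx\, dt$$ holds for any $\phi \in C^\infty(\mathbb R^{n+1})$ satisfying $\phi, \partial_t \phi, (-\Delta)^{1/2}\phi \in L^1 \cap L^\infty(\mathbb R^{n+1})$ and $\mathrm{supp}\, \phi \subset (-\infty,T] \times \mathbb R^n$. (Since $\phi$ vanishes for $t>T$, the time integrals are over $(0,T)$.) Maximal existence time: $T_m(u_0) = \sup\{T>0 : \text{there is a weak solution on } [0,T) \text{ with initial data } u_0\}$, with the convention that the supremum of the empty set is $0$. A weak solution is called global when $T_m = \infty$. *)

theory Defs
  imports "HOL-Analysis.Analysis"
begin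

text \<open>Space-time \<open>\<real>\<^sup>n\<^sup>+\<^sup>1\<close> is the product type \<open>real \<times> (real ^ 'n)\<close>
  with \<open>n = CARD('n)\<close>; its \<open>lborel\<close> is the product of the two Lebesgue-Borel measures.\<close>

primrec C_k :: "nat \<Rightarrow> ('a::euclidean_space \<Rightarrow> 'b::real_normed_vector) \<Rightarrow> bool" where
  "C_k 0 f \<longleftrightarrow> continuous_on UNIV f"
| "C_k (Suc k) f \<longleftrightarrow>
     (\<forall>x. f differentiable (at x)) \<and> (\<forall>v. C_k k (\<lambda>x. frechet_derivative f (at x) v))"

definition C_infinity :: "('a::euclidean_space \<Rightarrow> 'b::real_normed_vector) \<Rightarrow> bool" where
  "C_infinity f \<longleftrightarrow> (\<forall>k. C_k k f)"

definition L1_Linf :: "('a::euclidean_space \<Rightarrow> complex) \<Rightarrow> bool" where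
  "L1_Linf h \<longleftrightarrow> integrable lborel h \<and> (\<exists>M. AE z in lborel. norm (h z) \<le> M)"

definition fourier :: "(real ^ 'n \<Rightarrow> complex) \<Rightarrow> real ^ 'n \<Rightarrow> complex" where
  "fourier h \<xi> = (LINT x|lborel. exp (- \<i> * of_real (x \<bullet> \<xi>)) * h x)"

text \<open>\<open>is_half_laplacian h g\<close>: the tempered distribution \<open>\<F>\<^sup>-\<^sup>1 \<bar>\<xi>\<bar> \<F> h\<close> of an integrable
  function \<open>h\<close> is the integrable function \<open>g\<close>. Since \<open>\<F>\<close> is injective, \<open>g\<close> is unique up to a
  null set, and a multiplicative normalisation of \<open>\<F>\<close> does not matter. The integral formula for
  \<open>\<F>\<^sup>-\<^sup>1\<close> is avoided because \<open>\<bar>\<xi>\<bar> \<F> h\<close> need not be integrable.\<close>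

definition is_half_laplacian :: "(real ^ 'n \<Rightarrow> complex) \<Rightarrow> (real ^ 'n \<Rightarrow> complex) \<Rightarrow> bool" where
  "is_half_laplacian h g \<longleftrightarrow> integrable lborel h \<and> integrable lborel g \<and>
     (\<forall>\<xi>. fourier g \<xi> = of_real (norm \<xi>) * fourier h \<xi>)"

text \<open>For \<open>\<phi>\<close> and \<open>g\<close> integrable on space-time almost every time slice is integrable,
  and the identity \<open>g = (-\<Delta>)\<^sup>1\<^sup>/\<^sup>2 \<phi>\<close> of distributions holds slicewise for almost every \<open>t\<close>.\<close>

definition is_half_laplacian_x ::
    "(real \<times> (real ^ 'n) \<Rightarrow> complex) \<Rightarrow> (real \<times> (real ^ 'n) \<Rightarrow> complex) \<Rightarrow> bool" where
  "is_half_laplacian_x \<phi> g \<longleftrightarrow>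
     (AE t in lborel. is_half_laplacian (\<lambda>x. \<phi> (t, x)) (\<lambda>x. g (t, x)))"

definition time_deriv :: "(real \<times> (real ^ 'n) \<Rightarrow> complex) \<Rightarrow> real \<times> (real ^ 'n) \<Rightarrow> complex" where
  "time_deriv \<phi> = (\<lambda>(t, x). vector_derivative (\<lambda>s. \<phi> (s, x)) (at t))"

text \<open>A test function comes with a representative \<open>g\<close> of \<open>(-\<Delta>)\<^sup>1\<^sup>/\<^sup>2 \<phi>\<close>.\<close>

definition test_function ::
    "real \<Rightarrow> (real \<times> (real ^ 'n) \<Rightarrow> complex) \<Rightarrow> (real \<times> (real ^ 'n) \<Rightarrow> complex) \<Rightarrow> bool" where
  "test_function T \<phi> g \<longleftrightarrow>
     C_infinity \<phi> \<and> is_half_laplacian_x \<phi> g \<and>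
     L1_Linf \<phi> \<and> L1_Linf (time_deriv \<phi>) \<and> L1_Linf g \<and>
     closure {z. \<phi> z \<noteq> 0} \<subseteq> {..T} \<times> UNIV"

text \<open>\<open>u \<in> L\<^sup>1\<^sub>l\<^sub>o\<^sub>c(0,T; L\<^sup>q)\<close>, with \<open>u\<close> represented by a Borel function of \<open>(t,x)\<close>
  (every class has such a representative).\<close>

definition L1loc_Lq :: "real \<Rightarrow> real \<Rightarrow> (real \<times> (real ^ 'n) \<Rightarrow> complex) \<Rightarrow> bool" where
  "L1loc_Lq T q u \<longleftrightarrow>
     set_borel_measurable borel ({0<..<T} \<times> UNIV) u \<and>
     (AE t in lborel. t \<in> {0<..<T} \<longrightarrow> integrable lborel (\<lambda>x. norm (u (t, x)) powr q)) \<and>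
     (\<forall>a b. 0 < a \<longrightarrow> a < b \<longrightarrow> b < T \<longrightarrow>
        set_integrable lborel {a..b}
          (\<lambda>t. (LINT x|lborel. norm (u (t, x)) powr q) powr (1 / q)))"

text \<open>The membership \<open>u \<in> L\<^sup>1\<^sub>l\<^sub>o\<^sub>c(0,T; L\<^sup>2) \<inter> L\<^sup>1\<^sub>l\<^sub>o\<^sub>c(0,T; L\<^sup>p)\<close> makes the spatial integrals of the
  weak identity converge absolutely for almost every \<open>t \<in> (0,T)\<close>, but not the time integrals
  (near \<open>0\<close> and \<open>T\<close>, and for \<open>\<bar>u\<bar>\<^sup>p\<close> anywhere). Their existence is part of the identity and is
  stated explicitly, as the integral of a non-integrable function is \<open>0\<close> here.
  The datum \<open>u0\<close> is only assumed Lebesgue measurable.\<close>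

definition weak_solution ::
    "real \<Rightarrow> real \<Rightarrow> (real ^ 'n \<Rightarrow> complex) \<Rightarrow> (real \<times> (real ^ 'n) \<Rightarrow> complex) \<Rightarrow> bool" where
  "weak_solution p T u0 u \<longleftrightarrow>
     0 < T \<and> integrable lebesgue u0 \<and> L1loc_Lq T 2 u \<and> L1loc_Lq T p u \<and>
     (\<forall>\<phi> g. test_function T \<phi> g \<longrightarrow>
        set_integrable lborel {0<..<T}
          (\<lambda>t. LINT x|lborel. u (t, x) * cnj (\<i> * time_deriv \<phi> (t, x) + g (t, x))) \<and>
        set_integrable lborel {0<..<T}
          (\<lambda>t. LINT x|lborel. of_real (norm (u (t, x)) powr p) * cnj (\<phi> (t, x))) \<and>
        (LINT t:{0<..<T}|lborel. LINT x|lborel.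
            u (t, x) * cnj (\<i> * time_deriv \<phi> (t, x) + g (t, x)))
        = \<i> * (LINT x|lebesgue. u0 x * cnj (\<phi> (0, x)))
          + (LINT t:{0<..<T}|lborel. LINT x|lborel.
              of_real (norm (u (t, x)) powr p) * cnj (\<phi> (t, x))))"

text \<open>In \<open>ennreal\<close> the supremum of the empty set is \<open>0\<close>.\<close>

definition max_existence_time :: "real \<Rightarrow> (real ^ 'n \<Rightarrow> complex) \<Rightarrow> ennreal" where
  "max_existence_time p u0 = (SUP T \<in> {T. 0 < T \<and> (\<exists>u. weak_solution p T u0 u)}. ennreal T)"

definition global_weak_solution ::
    "real \<Rightarrow> (real ^ 'n \<Rightarrow> complex) \<Rightarrow> (real \<times> (real ^ 'n) \<Rightarrow> complex) \<Rightarrow> bool" where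
  "global_weak_solution p u0 u \<longleftrightarrow>
     (\<exists>T>0. weak_solution p T u0 u) \<and> max_existence_time p u0 = \<infinity>"

end

theory Submission
  imports Defs
begin

text \<open>
  Let \<open>n = CARD('n)\<close>, so that \<open>p = (n + 1) / n\<close> has the conjugate exponent \<open>p' = n + 1\<close>.
  Testing the equation against a nonnegative \<open>\<phi>\<close>, taking real parts and applying Young's
  inequality to the left-hand side gives
  \<open>\<epsilon> \<integral> (- Im f) \<phi>(0, x) dx \<le> C \<integral>\<integral> \<bar>(i \<partial>\<^sub>t + (-\<Delta>)\<^sup>1\<^sup>/\<^sup>2) \<phi>\<bar>\<^sup>n\<^sup>+\<^sup>1 \<phi>\<^sup>-\<^sup>n dx dt\<close>,
  where the terms with \<open>\<bar>u\<bar>\<^sup>p \<phi>\<close> have cancelled. The right-hand side is a capacity of first order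
  with exponent \<open>n + 1\<close> in the space-time of dimension \<open>n + 1\<close>. This is the conformally invariant
  case, in which the capacity of a fixed ball relative to a ball of radius \<open>T\<close> has order
  \<open>(log T)\<^sup>-\<^sup>n\<close>. A test function that attains this order, up to constants, therefore gives
  \<open>\<epsilon> (log T)\<^sup>n \<le> C\<close>, which is the bound on the existence time.

  Such a function behaves like \<open>(log (2\<^sup>J / r))\<^sup>n\<^sup>+\<^sup>1\<close> at distance \<open>r\<close> from the origin of space-time,
  where \<open>2\<^sup>J \<le> T\<close>. It has to be smooth, to vanish for \<open>t > T\<close>, and to have a half Laplacian that
  is known with pointwise bounds, although the operator is nonlocal. All this holds for a weighted
  sum \<open>\<Sum>\<^sub>j\<^sub>\<le>\<^sub>J w\<^sub>j v\<^sub>j\<^sup>n\<^sup>+\<^sup>1\<close> (\<open>log_profile\<close>) of separated functions living at the dyadic scales \<open>2\<^sup>j\<close>.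
  The time factor of \<open>v\<^sub>j\<^sup>n\<^sup>+\<^sup>1\<close> is a power of a rescaled smooth bump, and its space factor is
  \<open>(2\<^sup>j / \<surd>(4\<^sup>j + \<bar>x\<bar>\<^sup>2))\<^sup>n\<^sup>+\<^sup>1\<close>, a multiple of the Poisson kernel \<open>P\<^sub>s\<close> of the upper half-space at height
  \<open>s = 2\<^sup>j\<close>, for which \<open>(-\<Delta>)\<^sup>1\<^sup>/\<^sup>2 P\<^sub>s = - \<partial>\<^sub>s P\<^sub>s\<close> is explicit (\<open>fourier_poisson_ds\<close>).

  The weights are chosen so that \<open>\<Sum>\<^sub>i\<^sub>\<ge>\<^sub>k w\<^sub>i = (J + 1 - k)\<^sup>n\<^sup>+\<^sup>1\<close>. For \<open>t \<ge> 0\<close> the \<open>v\<^sub>j\<close> increase with \<open>j\<close>; this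
  gives \<open>(J + 1 - k) v\<^sub>k \<le> \<psi>\<close> for every \<open>k\<close>, where \<open>\<psi>\<^sup>n\<^sup>+\<^sup>1\<close> is the test function, while
  \<open>w\<^sub>k \<le> (n + 1) (J + 1 - k)\<^sup>n\<close>. The derivatives at scale \<open>2\<^sup>k\<close> are thus controlled by \<open>\<psi>\<^sup>n\<close>, and a
  geometric summation over the scales yields the pointwise estimate
  \<open>\<bar>\<partial>\<^sub>t \<phi>\<bar> + \<bar>(-\<Delta>)\<^sup>1\<^sup>/\<^sup>2 \<phi>\<bar> \<le> C \<psi>\<^sup>n / (1 + t + \<bar>x\<bar>)\<close> (\<open>log_profile_estimate\<close>). After Young's inequality
  there remains \<open>\<integral>\<integral> (1 + t + \<bar>x\<bar>)\<^sup>-\<^sup>n\<^sup>-\<^sup>1 dx dt\<close> over \<open>0 < t < 2\<^sup>J\<close>, which is of order \<open>J\<close>, whereas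
  \<open>\<phi>(0, x)\<close> is at least \<open>(J + 1)\<^sup>n\<^sup>+\<^sup>1\<close> times a fixed positive function. Hence \<open>\<epsilon> (J + 1)\<^sup>n \<le> C\<close>
  whenever a solution exists up to a time \<open>T \<ge> 2\<^sup>J\<close> (\<open>weak_solution_log_bound\<close>).
\<close>

section \<open>Smooth functions built from explicit terms\<close>

text \<open>The classical flat function \<open>exp (- 1 / s)\<close> is the case \<open>k = 0\<close>. The negative powers of \<open>s\<close>
  are carried along because they make the family closed under differentiation.\<close>
definition flat_exp :: "nat \<Rightarrow> real \<Rightarrow> real" where
  "flat_exp k s = (if s > 0 then exp (- inverse s) * inverse s ^ k else 0)"

lemma flat_exp_nonneg: "flat_exp k s \<ge> 0"
  by (simp add: flat_exp_def)

lemma flat_exp_eq_0: "s \<le> 0 \<Longrightarrow> flat_exp k s = 0"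
  by (simp add: flat_exp_def)

text \<open>The left-hand side is a single term of the exponential series.\<close>
lemma power_div_fact_le_exp:
  fixes y :: real
  assumes "y \<ge> 0"
  shows "y ^ k / fact k \<le> exp y"
proof -
  have "(\<lambda>n. y ^ n / fact n) sums exp y"
    using exp_converges[of y] by (simp add: divide_inverse mult.commute)
  then have "sum (\<lambda>n. y ^ n / fact n) {k} \<le> exp y"
    using assms sums_unique summable_def
    by (metis (no_types, lifting) finite.intros divide_nonneg_nonneg fact_ge_zero
        sum_le_suminf zero_le_power)
  then show ?thesis by simp
qed

lemma flat_exp_le_fact: "flat_exp k s \<le> fact k"
proof (cases "s > 0")
  case True
  have "inverse s ^ k \<le> fact k * exp (inverse s)"
    using power_div_fact_le_exp[of "inverse s" k] True by (simp add: field_simps)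
  then show ?thesis
    using True by (simp add: flat_exp_def exp_minus field_simps)
qed (simp add: flat_exp_def)

lemma has_real_derivative_flat_exp:
  "(flat_exp k has_real_derivative flat_exp (k + 2) s - real k * flat_exp (k + 1) s) (at s)"
proof -
  consider "s > 0" | "s < 0" | "s = 0" by linarith
  then show ?thesis
  proof cases
    case 1
    have "((\<lambda>s. inverse s ^ k) has_real_derivative - (real k * inverse s ^ (k + 1))) (at s)"
    proof (induction k)
      case (Suc k)
      show ?case
        using DERIV_mult[OF DERIV_inverse Suc.IH] 1
        by (simp add: algebra_simps power2_eq_square)
    qed simp
    moreover have "((\<lambda>s. exp (- inverse s)) has_real_derivative exp (- inverse s) * inverse s ^ 2) (at s)"
      using 1 by (auto intro!: derivative_eq_intros simp: power2_eq_square)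
    ultimately have "((\<lambda>s. exp (- inverse s) * inverse s ^ k) has_real_derivative
        flat_exp (k + 2) s - real k * flat_exp (k + 1) s) (at s)"
      by (rule DERIV_cong[OF DERIV_mult[rotated]])
         (use 1 in \<open>simp add: flat_exp_def power2_eq_square algebra_simps\<close>)
    then show ?thesis
      by (rule has_field_derivative_transform_within[where d=s]) (use 1 in \<open>auto simp: flat_exp_def dist_real_def\<close>)
  next
    case 2
    have "((\<lambda>s. 0) has_real_derivative 0) (at s)" by simp
    then have "(flat_exp k has_real_derivative 0) (at s)"
      by (rule has_field_derivative_transform_within[where d="-s"]) (use 2 in \<open>auto simp: flat_exp_def dist_real_def\<close>)
    then show ?thesis using 2 by (simp add: flat_exp_def)
  next
    case 3
    \<comment> \<open>The difference quotient at \<open>0\<close> tends to \<open>0\<close> because \<open>flat_exp k h = h\<^sup>2 flat_exp (k + 2) h\<close>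
      and the last factor is bounded.\<close>
    have "norm (flat_exp k h / h) \<le> fact (k + 2) * \<bar>h\<bar>" for h :: real
    proof (cases "h > 0")
      case True
      have "flat_exp k h = flat_exp (k + 2) h * h ^ 2"
        using True by (simp add: flat_exp_def field_simps power2_eq_square)
      then have "flat_exp k h / h = flat_exp (k + 2) h * h"
        using True by (simp add: power2_eq_square)
      then show ?thesis
        using True flat_exp_le_fact[of "k+2" h] flat_exp_nonneg[of "k+2" h]
        by (simp add: abs_mult mult_right_mono del: fact_Suc)
    qed (simp add: flat_exp_def mult_le_0_iff del: fact_Suc)
    moreover have "((\<lambda>h::real. fact (k + 2) * \<bar>h\<bar>) \<longlongrightarrow> fact (k + 2) * \<bar>0\<bar>) (at 0)"
      by (intro tendsto_intros)
    ultimately have "((\<lambda>h. flat_exp k h / h) \<longlongrightarrow> 0) (at 0)"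
      by (intro Lim_null_comparison[of "\<lambda>h. flat_exp k h / h"]) (auto intro: always_eventually)
    then have "(flat_exp k has_real_derivative 0) (at 0)"
      by (simp add: DERIV_def flat_exp_def)
    then show ?thesis using 3 by (simp add: flat_exp_def)
  qed
qed

lemma has_real_derivative_inverse_sqrt:
  fixes y :: real
  assumes "y > 0"
  shows "((\<lambda>y. inverse (sqrt y)) has_real_derivative (- 1 / 2) * inverse (sqrt y) ^ 3) (at y)"
  using assms
  by (auto intro!: derivative_eq_intros simp: field_simps power2_eq_square eval_nat_numeral)

text \<open>Smoothness in the sense of iterated directional derivatives is awkward to prove for products
  and compositions one order at a time. A class of terms that is closed under directional
  derivatives avoids this: every member is then differentiable to all orders. The clauses are those
  that the test function and its derivatives need.\<close>
inductive smooth_term :: "('a::euclidean_space \<Rightarrow> real) \<Rightarrow> bool" where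
  const: "smooth_term (\<lambda>_. c)"
| linear: "smooth_term (\<lambda>z. z \<bullet> w)"
| add: "smooth_term f \<Longrightarrow> smooth_term g \<Longrightarrow> smooth_term (\<lambda>z. f z + g z)"
| mult: "smooth_term f \<Longrightarrow> smooth_term g \<Longrightarrow> smooth_term (\<lambda>z. f z * g z)"
| flat: "smooth_term f \<Longrightarrow> smooth_term (\<lambda>z. flat_exp k (f z))"
| inverse_sqrt: "smooth_term f \<Longrightarrow> (\<forall>z. f z > 0) \<Longrightarrow> smooth_term (\<lambda>z. inverse (sqrt (f z)))"

lemma smooth_term_sum:
  "(\<And>i. i \<in> I \<Longrightarrow> smooth_term (f i)) \<Longrightarrow> smooth_term (\<lambda>z. \<Sum>i\<in>I. f i z)"
  by (induction I rule: infinite_finite_induct) (auto intro: smooth_term.intros)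

lemma smooth_term_power: "smooth_term f \<Longrightarrow> smooth_term (\<lambda>z. f z ^ k)"
  by (induction k) (auto intro: smooth_term.intros)

lemma smooth_term_cmult: "smooth_term f \<Longrightarrow> smooth_term (\<lambda>z. c * f z)"
  by (intro smooth_term.intros)

lemma smooth_term_derivative:
  "smooth_term f \<Longrightarrow>
    \<exists>f'. (\<forall>z. (f has_derivative f' z) (at z)) \<and> (\<forall>v. smooth_term (\<lambda>z. f' z v))"
proof (induction rule: smooth_term.induct)
  case (const c)
  show ?case
    by (rule exI[of _ "\<lambda>_ _. 0"]) (auto intro: smooth_term.const)
next
  case (linear w)
  show ?case
    by (rule exI[of _ "\<lambda>_ v. v \<bullet> w"])
       (auto intro: smooth_term.const intro!: derivative_eq_intros)
next
  case (add f g)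
  then obtain f' g' where "\<And>z. (f has_derivative f' z) (at z)" "\<And>v. smooth_term (\<lambda>z. f' z v)"
     "\<And>z. (g has_derivative g' z) (at z)" "\<And>v. smooth_term (\<lambda>z. g' z v)" by blast
  then show ?case
    by (intro exI[of _ "\<lambda>z v. f' z v + g' z v"])
       (auto intro: smooth_term.intros has_derivative_add)
next
  case (mult f g)
  then obtain f' g' where "\<And>z. (f has_derivative f' z) (at z)" "\<And>v. smooth_term (\<lambda>z. f' z v)"
     "\<And>z. (g has_derivative g' z) (at z)" "\<And>v. smooth_term (\<lambda>z. g' z v)" by blast
  moreover from this mult.hyps have "smooth_term (\<lambda>z. f z * g' z v + f' z v * g z)" for v
    by (intro smooth_term.add smooth_term.mult) auto
  ultimately show ?case
    by (intro exI[of _ "\<lambda>z v. f z * g' z v + f' z v * g z"]) (auto intro: has_derivative_mult)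
next
  case (flat f k)
  then obtain f' where f': "\<And>z. (f has_derivative f' z) (at z)" "\<And>v. smooth_term (\<lambda>z. f' z v)"
    by blast
  have "((\<lambda>z. flat_exp k (f z)) has_derivative
      (\<lambda>v. f' z v * (flat_exp (k + 2) (f z) + (- real k) * flat_exp (k + 1) (f z)))) (at z)" for z
    using DERIV_compose_FDERIV[OF has_real_derivative_flat_exp f'(1)[of z], of k]
    by simp
  moreover have "smooth_term (\<lambda>z. f' z v *
      (flat_exp (k + 2) (f z) + (- real k) * flat_exp (k + 1) (f z)))" for v
    using flat.hyps f'(2) by (intro smooth_term.intros)
  ultimately show ?case
    by (intro exI[of _ "\<lambda>z v. f' z v *
      (flat_exp (k + 2) (f z) + (- real k) * flat_exp (k + 1) (f z))"]) blast
next
  case (inverse_sqrt f)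
  then obtain f' where f': "\<And>z. (f has_derivative f' z) (at z)" "\<And>v. smooth_term (\<lambda>z. f' z v)"
    by blast
  from DERIV_compose_FDERIV[OF has_real_derivative_inverse_sqrt f'(1)] inverse_sqrt.hyps
  have "((\<lambda>z. inverse (sqrt (f z))) has_derivative
      (\<lambda>v. f' z v * ((- 1 / 2) * inverse (sqrt (f z)) ^ 3))) (at z)" for z
    by blast
  moreover have "smooth_term (\<lambda>z. f' z v * ((- 1 / 2) * inverse (sqrt (f z)) ^ 3))" for v
    using inverse_sqrt.hyps f'(2)
    by (intro smooth_term.intros smooth_term_cmult smooth_term_power)
  ultimately show ?case
    by (intro exI[of _ "\<lambda>z v. f' z v * ((- 1 / 2) * inverse (sqrt (f z)) ^ 3)"]) blast
qed

lemma smooth_term_continuous: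
  assumes "smooth_term f"
  shows "continuous_on UNIV f"
  using smooth_term_derivative[OF assms]
  by (metis continuous_at_imp_continuous_on has_derivative_continuous)

lemma smooth_term_imp_C_infinity:
  assumes "smooth_term f"
  shows "C_infinity (\<lambda>z. complex_of_real (f z))"
proof -
  have "C_k k (\<lambda>z. complex_of_real (f z))" if "smooth_term f" for k and f :: "'a \<Rightarrow> real"
    using that
  proof (induction k arbitrary: f)
    case 0
    then show ?case
      using smooth_term_continuous by (auto intro: continuous_intros)
  next
    case (Suc k)
    obtain f' where f': "\<And>z. (f has_derivative f' z) (at z)" "\<And>v. smooth_term (\<lambda>z. f' z v)"
      using smooth_term_derivative[OF Suc.prems] by blast
    have d: "((\<lambda>z. complex_of_real (f z)) has_derivative (\<lambda>v. complex_of_real (f' z v))) (at z)" for z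
      by (rule has_derivative_of_real[OF f'(1)])
    have "frechet_derivative (\<lambda>z. complex_of_real (f z)) (at z) = (\<lambda>v. complex_of_real (f' z v))" for z
      using frechet_derivative_at[OF d] by simp
    then show ?case
      using Suc.IH[OF f'(2)] d by (auto simp: differentiable_def)
  qed
  with assms show ?thesis
    by (auto simp: C_infinity_def)
qed

section \<open>Integrals over Euclidean space\<close>

text \<open>At distance about \<open>2\<^sup>i\<close> from the origin the function has the size of \<open>2\<^sup>i\<close> to the power
  \<open>- (n + 1)\<close>, while the ball of this radius has volume of order \<open>2\<^sup>i\<close> to the power \<open>n\<close>. So the
  function is dominated by a sum of multiples of indicators of dyadic balls, and the integrals of
  the summands form a geometric series.\<close>
lemma integrable_inverse_one_plus_norm:
  "integrable lborel (\<lambda>x::'a::euclidean_space. inverse (1 + norm x) ^ (DIM('a) + 1))"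
proof -
  define m where "m = DIM('a) + 1"
  define f where "f i x = 2 ^ m * inverse (2 ^ m) ^ i * (indicator (ball 0 (2 ^ i)) x :: real)"
    for i :: nat and x :: 'a
  have f_nonneg: "0 \<le> f i x" for i x
    by (simp add: f_def)
  have summable_f: "summable (\<lambda>i. f i x)" for x
  proof (rule summable_comparison_test)
    show "\<exists>N. \<forall>i\<ge>N. norm (f i x) \<le> 2 ^ m * inverse (2 ^ m) ^ i"
      by (auto simp: f_def indicator_def)
    show "summable (\<lambda>i. 2 ^ m * inverse (2 ^ m) ^ i :: real)"
      using one_less_power[of "2::real" m]
      by (intro summable_mult summable_geometric) (simp add: m_def inverse_eq_divide)
  qed
  have int_f: "integrable lborel (f i)" for i
    unfolding f_def
    by (intro integrable_mult_right integrable_real_indicator) (auto simp: emeasure_ball)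
  have LINT_f: "(LINT x|lborel. norm (f i x)) = 2 ^ m * unit_ball_vol DIM('a) * (1 / 2) ^ i" for i
  proof -
    have "(LINT x|lborel. norm (f i x)) = 2 ^ m * inverse (2 ^ m) ^ i * measure lborel (ball (0::'a) (2 ^ i))"
      using f_nonneg by (simp add: f_def)
    also have "\<dots> = 2 ^ m * unit_ball_vol DIM('a) * (inverse (2 ^ m) ^ i * (2 ^ i) ^ DIM('a))"
      by (simp add: content_ball)
    also have "inverse (2 ^ m) ^ i * (2 ^ i) ^ DIM('a) = (1 / 2 :: real) ^ i"
      by (simp add: m_def field_simps flip: power_mult power_add)
    finally show ?thesis .
  qed
  have "integrable lborel (\<lambda>x. \<Sum>i. f i x)"
    by (rule integrable_suminf)
       (use int_f summable_f f_nonneg LINT_f in \<open>auto intro!: summable_mult summable_geometric\<close>)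
  then show ?thesis
  proof (rule Bochner_Integration.integrable_bound, goal_cases)
    case 2
    have "inverse (1 + norm x) ^ m \<le> (\<Sum>i. f i x)" for x :: 'a
    proof -
      define k where "k = (LEAST k. norm x < 2 ^ k)"
      have ex: "\<exists>k. norm x < 2 ^ k"
        by (rule real_arch_pow) simp
      have k: "norm x < 2 ^ k"
        unfolding k_def by (rule LeastI_ex[OF ex])
      have "2 ^ k \<le> 2 * (1 + norm x)"
      proof (cases k)
        case (Suc l)
        then have "\<not> norm x < 2 ^ l"
          using not_less_Least[of l "\<lambda>k. norm x < 2 ^ k"] by (simp add: k_def)
        then show ?thesis using Suc by simp
      qed auto
      then have "inverse (1 + norm x) \<le> 2 * inverse (2 ^ k)"
        by (simp add: field_simps add_pos_nonneg)
      then have "inverse (1 + norm x) ^ m \<le> (2 * inverse (2 ^ k)) ^ m"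
        by (intro power_mono) auto
      also have "\<dots> = f k x"
        using k by (simp add: f_def power_mult_distrib flip: power_mult power_inverse) (simp add: mult.commute)
      also have "\<dots> \<le> (\<Sum>i. f i x)"
        using sum_le_suminf[OF summable_f, of "{k}"] f_nonneg by simp
      finally show ?thesis .
    qed
    then show ?case
      by (auto simp: m_def intro: order_trans[OF _ abs_ge_self])
  qed measurable
qed

lemma lborel_scaling:
  fixes h :: "'a::euclidean_space \<Rightarrow> 'b::{banach, second_countable_topology}"
  assumes h: "integrable lborel h" and c: "c > 0"
  shows "integrable lborel (\<lambda>x. h (c *\<^sub>R x))"
    and "(LINT x|lborel. h (c *\<^sub>R x)) = inverse (c ^ DIM('a)) *\<^sub>R (LINT x|lborel. h x)"
proof -
  have [measurable]: "h \<in> borel_measurable borel"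
    using borel_measurable_integrable[OF h] by simp
  have eq: "lborel = density (distr lborel borel (\<lambda>x::'a. c *\<^sub>R x)) (\<lambda>_. ennreal (c ^ DIM('a)))"
    using lborel_affine[of c "0::'a"] c by simp
  have "integrable (density (distr lborel borel (\<lambda>x::'a. c *\<^sub>R x)) (\<lambda>_. ennreal (c ^ DIM('a)))) h"
    using h by (subst (asm) eq)
  then have "integrable lborel (\<lambda>x. c ^ DIM('a) *\<^sub>R h (c *\<^sub>R x))"
    using c by (subst (asm) integrable_density) (auto simp: integrable_distr_eq)
  from integrable_scaleR_right[OF this, of "inverse (c ^ DIM('a))"]
  show "integrable lborel (\<lambda>x. h (c *\<^sub>R x))"
    using c by simp
  have "(LINT x|lborel. h x) = c ^ DIM('a) *\<^sub>R (LINT x|lborel. h (c *\<^sub>R x))"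
    using c by (subst eq, subst integral_density) (auto simp: integral_distr)
  then show "(LINT x|lborel. h (c *\<^sub>R x)) = inverse (c ^ DIM('a)) *\<^sub>R (LINT x|lborel. h x)"
    using c by simp
qed

lemma lborel_translation:
  fixes h :: "'a::euclidean_space \<Rightarrow> 'b::{banach, second_countable_topology}"
  assumes [measurable]: "h \<in> borel_measurable borel"
  shows "(LINT x|lborel. h (x + c)) = (LINT x|lborel. h x)"
    and "integrable lborel (\<lambda>x. h (x + c)) \<longleftrightarrow> integrable lborel h"
proof -
  have "(LINT x|lborel. h x) = (LINT x|distr lborel borel ((+) c). h x)"
    by (simp add: lborel_distr_plus)
  then show "(LINT x|lborel. h (x + c)) = (LINT x|lborel. h x)"
    by (simp add: integral_distr add.commute)
  have "integrable lborel h \<longleftrightarrow> integrable (distr lborel borel ((+) c)) h"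
    by (simp add: lborel_distr_plus)
  then show "integrable lborel (\<lambda>x. h (x + c)) \<longleftrightarrow> integrable lborel h"
    by (simp add: integrable_distr_eq add.commute)
qed

lemma has_vector_derivative_quotient:
  "(f has_vector_derivative D) (at t) \<longleftrightarrow>
    ((\<lambda>s. (f s - f t) /\<^sub>R (s - t)) \<longlongrightarrow> D) (at t)"
proof -
  have "((\<lambda>s. (f s - f t) /\<^sub>R (s - t)) \<longlongrightarrow> D) (at t) \<longleftrightarrow>
      ((\<lambda>s. (f s - f t) /\<^sub>R (s - t) - D) \<longlongrightarrow> 0) (at t)"
    by (rule LIM_zero_iff[symmetric])
  also have "\<dots> \<longleftrightarrow> ((\<lambda>s. norm ((f s - f t) /\<^sub>R (s - t) - D)) \<longlongrightarrow> 0) (at t)"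
    by (simp add: tendsto_norm_zero_iff)
  also have "\<dots> \<longleftrightarrow> ((\<lambda>s. norm (f s - f t - (s - t) *\<^sub>R D) / norm (s - t)) \<longlongrightarrow> 0) (at t)"
  proof (rule filterlim_cong[OF refl refl])
    show "\<forall>\<^sub>F s in at t. norm ((f s - f t) /\<^sub>R (s - t) - D) =
        norm (f s - f t - (s - t) *\<^sub>R D) / norm (s - t)"
      unfolding eventually_at_filter
    proof (intro always_eventually allI impI)
      fix s assume "s \<noteq> t"
      then have "(f s - f t) /\<^sub>R (s - t) - D = (f s - f t - (s - t) *\<^sub>R D) /\<^sub>R (s - t)"
        by (simp add: scaleR_diff_right)
      then show "norm ((f s - f t) /\<^sub>R (s - t) - D) = norm (f s - f t - (s - t) *\<^sub>R D) / norm (s - t)"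
        by (simp only: norm_scaleR) (simp add: divide_inverse mult.commute)
    qed
  qed
  also have "\<dots> \<longleftrightarrow> (f has_vector_derivative D) (at t)"
    by (simp add: has_vector_derivative_def has_derivative_iff_norm bounded_linear_scaleR_left)
  finally show ?thesis by simp
qed

text \<open>Differentiation under the integral sign: by the mean value inequality the difference
  quotients have the same dominating function as the derivative.\<close>
lemma has_vector_derivative_integral:
  fixes F :: "real \<Rightarrow> 'a \<Rightarrow> 'b::{banach, second_countable_topology}"
  assumes d: "d > 0"
    and int: "\<And>t. \<bar>t - t0\<bar> < d \<Longrightarrow> integrable M (F t)"
    and der: "\<And>t x. \<bar>t - t0\<bar> < d \<Longrightarrow> ((\<lambda>t. F t x) has_vector_derivative F' t x) (at t)"
    and bound: "\<And>t x. \<bar>t - t0\<bar> < d \<Longrightarrow> norm (F' t x) \<le> w x"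
    and w: "integrable M w"
  shows "integrable M (F' t0)"
    and "((\<lambda>t. LINT x|M. F t x) has_vector_derivative (LINT x|M. F' t0 x)) (at t0)"
proof -
  have main: "integrable M (F' t0) \<and>
      (\<lambda>n. (LINT x|M. (F (X n) x - F t0 x) /\<^sub>R (X n - t0))) \<longlonglongrightarrow> (LINT x|M. F' t0 x)"
    if X: "\<And>n. X n \<noteq> t0" "\<And>n. \<bar>X n - t0\<bar> < d" "X \<longlonglongrightarrow> t0" for X :: "nat \<Rightarrow> real"
  proof -
    let ?q = "\<lambda>n x. (F (X n) x - F t0 x) /\<^sub>R (X n - t0)"
    have q_int: "integrable M (?q n)" for n
      using int X(2) d by (intro integrable_scaleR_right Bochner_Integration.integrable_diff) auto
    have lim: "(\<lambda>n. ?q n x) \<longlonglongrightarrow> F' t0 x" for x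
    proof -
      have "((\<lambda>s. (F s x - F t0 x) /\<^sub>R (s - t0)) \<longlongrightarrow> F' t0 x) (at t0)"
        using der[of t0 x] d by (simp add: has_vector_derivative_quotient)
      then show ?thesis
        using X unfolding tendsto_at_iff_sequentially by (simp add: o_def)
    qed
    have q_bound: "norm (?q n x) \<le> w x" for n x
    proof -
      have "norm (F (X n) x - F t0 x) \<le> w x * norm (X n - t0)"
      proof (rule differentiable_bound[where S="{t0 - d<..<t0 + d}"])
        fix t assume "t \<in> {t0 - d<..<t0 + d}"
        then have t: "\<bar>t - t0\<bar> < d" by auto
        show "((\<lambda>t. F t x) has_derivative (\<lambda>h. h *\<^sub>R F' t x)) (at t within {t0 - d<..<t0 + d})"
          using der[OF t, of x] unfolding has_vector_derivative_def
          by (rule has_derivative_at_withinI)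
        show "onorm (\<lambda>h. h *\<^sub>R F' t x) \<le> w x"
          using bound[OF t, of x] onorm_scaleR_left[OF bounded_linear_ident, of "F' t x"]
          by (simp add: onorm_id)
      qed (use X(2)[of n] d in \<open>auto simp: abs_if split: if_splits\<close>)
      then show ?thesis
        using X(1)[of n] by (simp add: divide_simps mult.commute)
    qed
    have m: "F' t0 \<in> borel_measurable M"
      by (rule borel_measurable_LIMSEQ_metric[OF borel_measurable_integrable[OF q_int] lim])
    show ?thesis
    proof
      show "integrable M (F' t0)"
        by (rule integrable_dominated_convergence[where w=w and s="?q"])
           (use m w lim q_bound borel_measurable_integrable[OF q_int] in auto)
      show "(\<lambda>n. LINT x|M. ?q n x) \<longlonglongrightarrow> (LINT x|M. F' t0 x)"
        by (rule integral_dominated_convergence[where w=w])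
           (use m w lim q_bound borel_measurable_integrable[OF q_int] in auto)
    qed
  qed
  have quot: "(LINT x|M. (F s x - F t0 x) /\<^sub>R (s - t0)) =
      ((LINT x|M. F s x) - (LINT x|M. F t0 x)) /\<^sub>R (s - t0)" if "\<bar>s - t0\<bar> < d" for s
    using int[OF that] int[of t0] d by simp
  show "integrable M (F' t0)"
  proof -
    have "(\<lambda>n. t0 + d / 2 * inverse (real (Suc n))) \<longlonglongrightarrow> t0 + d / 2 * 0"
      by (intro tendsto_intros LIMSEQ_inverse_real_of_nat)
    moreover have "d / 2 * inverse (real (Suc n)) < d" for n
    proof -
      have "d / 2 * inverse (real (Suc n)) \<le> d / 2 * 1"
        using d by (intro mult_left_mono) (auto simp: field_simps)
      then show ?thesis using d by simp
    qed
    ultimately show ?thesis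
      using main[of "\<lambda>n. t0 + d / 2 * inverse (real (Suc n))"] d by (auto simp: abs_mult)
  qed
  show "((\<lambda>t. LINT x|M. F t x) has_vector_derivative (LINT x|M. F' t0 x)) (at t0)"
    unfolding has_vector_derivative_quotient
  proof (subst tendsto_cong)
    show "\<forall>\<^sub>F s in at t0. ((LINT x|M. F s x) - (LINT x|M. F t0 x)) /\<^sub>R (s - t0) =
        (LINT x|M. (F (if \<bar>s - t0\<bar> < d then s else t0 + d / 2) x - F t0 x) /\<^sub>R
                   ((if \<bar>s - t0\<bar> < d then s else t0 + d / 2) - t0))"
      unfolding eventually_at
    proof (intro exI[of _ d] conjI ballI impI d)
      fix s assume "s \<noteq> t0 \<and> dist s t0 < d"
      then have s: "\<bar>s - t0\<bar> < d" by (simp add: dist_real_def)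
      show "((LINT x|M. F s x) - (LINT x|M. F t0 x)) /\<^sub>R (s - t0) =
        (LINT x|M. (F (if \<bar>s - t0\<bar> < d then s else t0 + d / 2) x - F t0 x) /\<^sub>R
                   ((if \<bar>s - t0\<bar> < d then s else t0 + d / 2) - t0))"
        unfolding if_P[OF s] by (rule quot[OF s, symmetric])
    qed
    show "((\<lambda>s. LINT x|M. (F (if \<bar>s - t0\<bar> < d then s else t0 + d / 2) x - F t0 x) /\<^sub>R
        ((if \<bar>s - t0\<bar> < d then s else t0 + d / 2) - t0)) \<longlongrightarrow> (LINT x|M. F' t0 x)) (at t0)"
      \<comment> \<open>Points at distance at least \<open>d\<close>, where nothing is assumed, are replaced by \<open>t0 + d / 2\<close>;
        this does not affect the limit.\<close>
      unfolding tendsto_at_iff_sequentially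
    proof (intro allI impI)
      fix X :: "nat \<Rightarrow> real"
      assume X: "\<forall>i. X i \<in> UNIV - {t0}" "X \<longlonglongrightarrow> t0"
      define Y where "Y n = (if \<bar>X n - t0\<bar> < d then X n else t0 + d / 2)" for n
      have "\<forall>\<^sub>F n in sequentially. \<bar>X n - t0\<bar> < d"
        using tendstoD[OF X(2) d] by (simp add: dist_real_def)
      then have "\<forall>\<^sub>F n in sequentially. X n = Y n"
        by eventually_elim (simp add: Y_def)
      with X(2) have "Y \<longlonglongrightarrow> t0"
        by (rule Lim_transform_eventually)
      moreover have "Y n \<noteq> t0" "\<bar>Y n - t0\<bar> < d" for n
        using X(1) d by (auto simp: Y_def)
      ultimately show "((\<lambda>s. LINT x|M. (F (if \<bar>s - t0\<bar> < d then s else t0 + d / 2) x - F t0 x) /\<^sub>R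
        ((if \<bar>s - t0\<bar> < d then s else t0 + d / 2) - t0)) \<circ> X) \<longlonglongrightarrow> (LINT x|M. F' t0 x)"
        using main[of Y] unfolding o_def Y_def by blast
    qed
  qed
qed

section \<open>The Poisson kernel of the upper half-space\<close>

text \<open>The reciprocal of the distance between \<open>(0, 0)\<close> and \<open>(s, x)\<close> in the half-space \<open>s > 0\<close>.
  Everything below is a polynomial in \<open>s\<close>, \<open>x\<close> and this function.\<close>
definition inv_dist :: "real \<Rightarrow> 'a::euclidean_space \<Rightarrow> real" where
  "inv_dist s x = inverse (sqrt (s\<^sup>2 + (norm x)\<^sup>2))"

lemma inv_dist_pos: "s > 0 \<Longrightarrow> inv_dist s x > 0"
  by (simp add: inv_dist_def add_pos_nonneg)

lemma inv_dist_nonneg: "inv_dist s x \<ge> 0"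
  by (simp add: inv_dist_def)

lemma inv_dist_mult_le: "s > 0 \<Longrightarrow> s * inv_dist s x \<le> 1"
  by (auto simp: inv_dist_def field_simps add_pos_nonneg intro!: real_le_rsqrt)

lemma norm_mult_inv_dist_le: "s > 0 \<Longrightarrow> norm x * inv_dist s x \<le> 1"
  by (auto simp: inv_dist_def field_simps add_pos_nonneg intro!: real_le_rsqrt)

lemma inv_dist_square: "s > 0 \<Longrightarrow> (inv_dist s x)\<^sup>2 * (s\<^sup>2 + (norm x)\<^sup>2) = 1"
  by (simp add: inv_dist_def power_inverse add_pos_nonneg less_imp_neq[symmetric])

lemma inv_dist_measurable [measurable]: "inv_dist s \<in> borel_measurable borel"
  unfolding inv_dist_def by measurable

lemma inv_dist_scale: "s > 0 \<Longrightarrow> inv_dist s x = inverse s * inv_dist 1 (inverse s *\<^sub>R x)"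
proof -
  assume s: "s > 0"
  have "s\<^sup>2 + (norm x)\<^sup>2 = s\<^sup>2 * (1 + (norm (inverse s *\<^sub>R x))\<^sup>2)"
    using s by (simp add: field_simps)
  then have "sqrt (s\<^sup>2 + (norm x)\<^sup>2) = s * sqrt (1 + (norm (inverse s *\<^sub>R x))\<^sup>2)"
    using s by (simp add: real_sqrt_mult)
  then show ?thesis by (simp add: inv_dist_def)
qed

lemma inv_dist_antimono: "0 < r \<Longrightarrow> r \<le> s \<Longrightarrow> inv_dist s x \<le> inv_dist r x"
  unfolding inv_dist_def
  by (intro le_imp_inverse_le real_sqrt_le_mono add_mono power_mono) (auto simp: add_pos_nonneg)

lemma inv_dist_le: "s > 0 \<Longrightarrow> inv_dist s x \<le> (1 + inverse s) * inverse (1 + norm x)"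
proof -
  assume s: "s > 0"
  have "s * (norm x * inv_dist s x) \<le> s * 1"
    using s norm_mult_inv_dist_le[OF s] by (intro mult_left_mono) auto
  then have "s * inv_dist s x + s * (norm x * inv_dist s x) \<le> 1 + s"
    using inv_dist_mult_le[OF s, of x] by linarith
  then show ?thesis
    using s by (simp add: field_simps add_pos_nonneg)
qed

text \<open>Moving \<open>x\<close> by at most \<open>1\<close> changes the distance by a bounded factor. This provides dominating
  functions for difference quotients in \<open>x\<close>.\<close>
lemma inv_dist_perturb:
  assumes s: "s > 0" and y: "norm (y - x) \<le> 1"
  shows "inv_dist s y \<le> (2 + inverse s) * inv_dist s x"
proof -
  have "sqrt (s\<^sup>2 + (norm x)\<^sup>2) \<le> (2 + inverse s) * sqrt (s\<^sup>2 + (norm y)\<^sup>2)"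
  proof -
    have "sqrt (s\<^sup>2 + (norm x)\<^sup>2) \<le> s + norm x"
      using s sqrt_sum_squares_le_sum[of s "norm x"] by simp
    also have "\<dots> \<le> s + (norm y + 1)"
      using y norm_triangle_ineq2[of x y] by (simp add: norm_minus_commute)
    also have "\<dots> \<le> sqrt (s\<^sup>2 + (norm y)\<^sup>2) + (sqrt (s\<^sup>2 + (norm y)\<^sup>2) + inverse s * sqrt (s\<^sup>2 + (norm y)\<^sup>2))"
    proof -
      have "s \<le> sqrt (s\<^sup>2 + (norm y)\<^sup>2)" "norm y \<le> sqrt (s\<^sup>2 + (norm y)\<^sup>2)"
        by (auto intro!: real_le_rsqrt)
      moreover from this(1) have "1 \<le> inverse s * sqrt (s\<^sup>2 + (norm y)\<^sup>2)"
        using s by (simp add: field_simps)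
      ultimately show ?thesis by linarith
    qed
    finally show ?thesis by (simp add: algebra_simps)
  qed
  moreover have "sqrt (s\<^sup>2 + (norm x)\<^sup>2) > 0" "sqrt (s\<^sup>2 + (norm y)\<^sup>2) > 0"
    using s by (auto simp: add_pos_nonneg)
  ultimately show ?thesis
    unfolding inv_dist_def by (simp add: field_simps)
qed

lemma integrable_inv_dist_power:
  "s > 0 \<Longrightarrow> integrable lborel (\<lambda>x::'a::euclidean_space. inv_dist s x ^ (DIM('a) + 1))"
proof (rule Bochner_Integration.integrable_bound)
  assume s: "s > 0"
  show "integrable lborel (\<lambda>x::'a. ((1 + inverse s) * inverse (1 + norm x)) ^ (DIM('a) + 1))"
    unfolding power_mult_distrib by (intro integrable_mult_right integrable_inverse_one_plus_norm)
  show "AE x in lborel. norm (inv_dist s (x::'a) ^ (DIM('a) + 1))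
      \<le> norm (((1 + inverse s) * inverse (1 + norm x)) ^ (DIM('a) + 1))"
    using s
    by (intro AE_I2) (auto simp: norm_power abs_of_nonneg inv_dist_nonneg simp del: power_Suc
        intro!: power_mono inv_dist_le abs_of_nonneg order_trans[OF inv_dist_le abs_ge_self])
qed measurable

text \<open>By scaling. The integral of the Poisson kernel itself is therefore the same at every height.\<close>
lemma integral_inv_dist_power:
  assumes "s > 0"
  shows "(LINT x|lborel. inv_dist s (x::'a::euclidean_space) ^ (DIM('a) + 1)) =
     inverse s * (LINT x|lborel. inv_dist 1 (x::'a) ^ (DIM('a) + 1))"
proof -
  have "(LINT x|lborel. inv_dist s (x::'a) ^ (DIM('a) + 1)) =
      (LINT x|lborel. inverse s ^ (DIM('a) + 1) * inv_dist 1 (inverse s *\<^sub>R x::'a) ^ (DIM('a) + 1))"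
    by (simp only: inv_dist_scale[OF assms] power_mult_distrib)
  also have "\<dots> = inverse s ^ (DIM('a) + 1) * (inverse (inverse s ^ DIM('a)) *\<^sub>R
      (LINT x|lborel. inv_dist 1 (x::'a) ^ (DIM('a) + 1)))"
    using assms integrable_inv_dist_power[of 1, where 'a='a]
    by (subst lborel_scaling(2)[symmetric]) simp_all
  finally show ?thesis
    using assms by (simp add: power_inverse)
qed

text \<open>The Poisson kernel of \<open>\<real>\<^sup>n\<close> at height \<open>s\<close>, up to its normalising constant, and its
  derivatives in \<open>s\<close> and in a direction \<open>b\<close> of space.\<close>
definition poisson :: "real \<Rightarrow> 'a::euclidean_space \<Rightarrow> real" where
  "poisson s x = s * inv_dist s x ^ (DIM('a) + 1)"

definition poisson_ds :: "real \<Rightarrow> 'a::euclidean_space \<Rightarrow> real" where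
  "poisson_ds s x = inv_dist s x ^ (DIM('a) + 1)
     - (real DIM('a) + 1) * s\<^sup>2 * inv_dist s x ^ (DIM('a) + 3)"

definition poisson_dss :: "real \<Rightarrow> 'a::euclidean_space \<Rightarrow> real" where
  "poisson_dss s x = (real DIM('a) + 1) * (real DIM('a) + 3) * s ^ 3 * inv_dist s x ^ (DIM('a) + 5)
     - 3 * (real DIM('a) + 1) * s * inv_dist s x ^ (DIM('a) + 3)"

definition poisson_dx :: "real \<Rightarrow> 'a::euclidean_space \<Rightarrow> 'a \<Rightarrow> real" where
  "poisson_dx s b x = - (real DIM('a) + 1) * s * (x \<bullet> b) * inv_dist s x ^ (DIM('a) + 3)"

definition poisson_dxx :: "real \<Rightarrow> 'a::euclidean_space \<Rightarrow> 'a \<Rightarrow> real" where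
  "poisson_dxx s b x = (real DIM('a) + 1) * (real DIM('a) + 3) * s * (x \<bullet> b)\<^sup>2 * inv_dist s x ^ (DIM('a) + 5)
     - (real DIM('a) + 1) * s * inv_dist s x ^ (DIM('a) + 3)"

lemma poisson_harmonic:
  assumes s: "s > 0"
  shows "poisson_dss s x + (\<Sum>b\<in>Basis. poisson_dxx s b x) = 0"
proof -
  define n where "n = real DIM('a)"
  define k where "k = inv_dist s x"
  have norm_sq: "(norm x)\<^sup>2 = (\<Sum>b\<in>Basis. (x \<bullet> b)\<^sup>2)"
    unfolding power2_norm_eq_inner using euclidean_inner[of x x] by (simp add: power2_eq_square)
  have sum: "(\<Sum>b\<in>Basis. poisson_dxx s b x) =
      (n + 1) * (n + 3) * s * (norm x)\<^sup>2 * k ^ (DIM('a) + 5) - n * ((n + 1) * s * k ^ (DIM('a) + 3))"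
    by (simp add: poisson_dxx_def sum_subtractf n_def k_def norm_sq
          flip: sum_distrib_left sum_distrib_right)
  have "k ^ (DIM('a) + 5) * (s\<^sup>2 + (norm x)\<^sup>2) = k ^ (DIM('a) + 3) * (k\<^sup>2 * (s\<^sup>2 + (norm x)\<^sup>2))"
    by (simp add: eval_nat_numeral algebra_simps)
  also have "\<dots> = k ^ (DIM('a) + 3)"
    unfolding k_def inv_dist_square[OF s] by simp
  finally have *: "k ^ (DIM('a) + 5) * (norm x)\<^sup>2 = k ^ (DIM('a) + 3) - k ^ (DIM('a) + 5) * s\<^sup>2"
    by (simp add: algebra_simps)
  have "poisson_dss s x + (\<Sum>b\<in>Basis. poisson_dxx s b x) =
      (n + 1) * (n + 3) * s * (k ^ (DIM('a) + 5) * s\<^sup>2 + k ^ (DIM('a) + 5) * (norm x)\<^sup>2)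
      - (n + 1) * (n + 3) * s * k ^ (DIM('a) + 3)"
    unfolding sum poisson_dss_def k_def[symmetric] n_def[symmetric]
    by (simp add: n_def algebra_simps power2_eq_square power3_eq_cube)
  also have "\<dots> = 0"
    unfolding * by (simp add: algebra_simps)
  finally show ?thesis .
qed

lemma has_real_derivative_inv_dist:
  assumes "s > 0"
  shows "((\<lambda>s. inv_dist s x) has_real_derivative - (s * inv_dist s x ^ 3)) (at s)"
proof -
  have "s\<^sup>2 + (norm x)\<^sup>2 > 0" using assms by (simp add: add_pos_nonneg)
  then show ?thesis
    unfolding inv_dist_def
    by (auto intro!: derivative_eq_intros simp: field_simps eval_nat_numeral)
qed

lemma has_real_derivative_inv_dist_line:
  assumes "s > 0"
  shows "((\<lambda>t. inv_dist s (x + t *\<^sub>R b)) has_real_derivative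
     - (((x + t *\<^sub>R b) \<bullet> b) * inv_dist s (x + t *\<^sub>R b) ^ 3)) (at t)"
proof -
  have *: "s\<^sup>2 + ((norm x)\<^sup>2 + 2 * t * (x \<bullet> b) + t\<^sup>2 * (b \<bullet> b)) = s\<^sup>2 + (norm (x + t *\<^sub>R b))\<^sup>2" for t
    unfolding power2_norm_eq_inner
    by (simp add: inner_simps inner_commute power2_eq_square algebra_simps)
  have pos: "s\<^sup>2 + ((norm x)\<^sup>2 + 2 * t * (x \<bullet> b) + t\<^sup>2 * (b \<bullet> b)) > 0"
    unfolding * using assms by (simp add: add_pos_nonneg)
  have "((\<lambda>t. s\<^sup>2 + ((norm x)\<^sup>2 + 2 * t * (x \<bullet> b) + t\<^sup>2 * (b \<bullet> b))) has_real_derivative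
      2 * ((x + t *\<^sub>R b) \<bullet> b)) (at t)"
    by (auto intro!: derivative_eq_intros simp: inner_simps)
  from DERIV_chain2[OF has_real_derivative_inverse_sqrt[OF pos] this] show ?thesis
    unfolding inv_dist_def * by (rule DERIV_cong) simp
qed

lemma has_real_derivative_inv_dist_power:
  assumes "s > 0"
  shows "((\<lambda>s. inv_dist s x ^ k) has_real_derivative - (real k * s * inv_dist s x ^ (k + 2))) (at s)"
  by (rule DERIV_cong[OF DERIV_power[OF has_real_derivative_inv_dist[OF assms]]])
     (cases k; simp add: eval_nat_numeral algebra_simps)

lemma has_real_derivative_inv_dist_power_line:
  assumes "s > 0"
  shows "((\<lambda>t. inv_dist s (x + t *\<^sub>R b) ^ k) has_real_derivative
     - (real k * ((x + t *\<^sub>R b) \<bullet> b) * inv_dist s (x + t *\<^sub>R b) ^ (k + 2))) (at t)"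
  by (rule DERIV_cong[OF DERIV_power[OF has_real_derivative_inv_dist_line[OF assms]]])
     (cases k; simp add: eval_nat_numeral algebra_simps)

lemma poisson_derivatives:
  assumes s: "s > 0"
  shows "((\<lambda>s. poisson s x) has_real_derivative poisson_ds s x) (at s)"
    and "((\<lambda>s. poisson_ds s x) has_real_derivative poisson_dss s x) (at s)"
proof -
  have *: "DIM('a) + 1 + 2 = DIM('a) + 3" "DIM('a) + 3 + 2 = DIM('a) + 5" by simp_all
  note d1 = has_real_derivative_inv_dist_power[OF s, of x "DIM('a) + 1", unfolded *]
  note d3 = has_real_derivative_inv_dist_power[OF s, of x "DIM('a) + 3", unfolded *]
  show "((\<lambda>s. poisson s x) has_real_derivative poisson_ds s x) (at s)"
    unfolding poisson_def poisson_ds_def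
    by (rule DERIV_cong[OF DERIV_mult[OF DERIV_ident d1]])
       (simp add: power2_eq_square algebra_simps)
  show "((\<lambda>s. poisson_ds s x) has_real_derivative poisson_dss s x) (at s)"
    unfolding poisson_ds_def poisson_dss_def
    by (rule DERIV_cong[OF DERIV_diff[OF d1 DERIV_mult[OF DERIV_cmult[OF DERIV_power[OF DERIV_ident]] d3]]])
       (simp add: power2_eq_square power3_eq_cube algebra_simps)
qed

lemma poisson_derivatives_line:
  assumes s: "s > 0" and b: "norm b = 1"
  shows "((\<lambda>t. poisson s (x + t *\<^sub>R b)) has_real_derivative poisson_dx s b (x + t *\<^sub>R b)) (at t)"
    and "((\<lambda>t. poisson_dx s b (x + t *\<^sub>R b)) has_real_derivative poisson_dxx s b (x + t *\<^sub>R b)) (at t)"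
proof -
  have *: "DIM('a) + 1 + 2 = DIM('a) + 3" "DIM('a) + 3 + 2 = DIM('a) + 5" by simp_all
  note d1 = has_real_derivative_inv_dist_power_line[OF s, of x b "DIM('a) + 1", unfolded *]
  note d3 = has_real_derivative_inv_dist_power_line[OF s, of x b "DIM('a) + 3", unfolded *]
  show "((\<lambda>t. poisson s (x + t *\<^sub>R b)) has_real_derivative poisson_dx s b (x + t *\<^sub>R b)) (at t)"
    unfolding poisson_def poisson_dx_def
    by (rule DERIV_cong[OF DERIV_cmult[OF d1]]) (simp add: algebra_simps)
  have bb: "b \<bullet> b = 1" using b by (simp add: norm_eq_1)
  have lin: "((\<lambda>t. (x + t *\<^sub>R b) \<bullet> b) has_real_derivative 1) (at t)"
    by (auto simp: inner_simps bb intro!: derivative_eq_intros)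
  show "((\<lambda>t. poisson_dx s b (x + t *\<^sub>R b)) has_real_derivative poisson_dxx s b (x + t *\<^sub>R b)) (at t)"
    unfolding poisson_dx_def poisson_dxx_def
    by (rule DERIV_cong[OF DERIV_mult[OF DERIV_cmult[OF lin] d3]])
       (simp add: power2_eq_square algebra_simps)
qed

lemma poisson_measurable [measurable]:
  "poisson s \<in> borel_measurable borel" "poisson_ds s \<in> borel_measurable borel"
  unfolding poisson_def poisson_ds_def
  by measurable

text \<open>In terms of \<open>p = s k\<close> and \<open>q = (x \<bullet> b) k\<close>, with \<open>k = inv_dist s x\<close>, all derivatives are
  polynomials in quantities of modulus at most \<open>1\<close>, times \<open>k\<^sup>n\<^sup>+\<^sup>1\<close> and powers of \<open>s\<close>. The constant
  \<open>c\<close> is the largest of the sums of their coefficients.\<close>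
lemma poisson_bounds:
  fixes x b :: "'a::euclidean_space"
  defines "c \<equiv> (real DIM('a) + 1) * (real DIM('a) + 6)"
  assumes s: "s > 0" and b: "norm b = 1"
  shows "\<bar>poisson s x\<bar> \<le> s * inv_dist s x ^ (DIM('a) + 1)"
    and "\<bar>poisson_ds s x\<bar> \<le> c * inv_dist s x ^ (DIM('a) + 1)"
    and "\<bar>poisson_dss s x\<bar> \<le> c / s * inv_dist s x ^ (DIM('a) + 1)"
    and "\<bar>poisson_dx s b x\<bar> \<le> c * inv_dist s x ^ (DIM('a) + 1)"
    and "\<bar>poisson_dxx s b x\<bar> \<le> c / s * inv_dist s x ^ (DIM('a) + 1)"
proof -
  define n where "n = real DIM('a)"
  define k where "k = inv_dist s x"
  define K where "K = inv_dist s x ^ (DIM('a) + 1)"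
  define p where "p = s * k"
  define q where "q = (x \<bullet> b) * k"
  have K: "K \<ge> 0" and k: "k > 0"
    using s by (auto simp: K_def k_def inv_dist_nonneg inv_dist_pos)
  have n: "n \<ge> 0" by (simp add: n_def)
  have p: "0 \<le> p" "p \<le> 1"
    using s k inv_dist_mult_le[OF s, of x] by (auto simp: p_def k_def)
  have "\<bar>q\<bar> \<le> norm x * k"
    using Cauchy_Schwarz_ineq2[of x b] b k by (simp add: q_def abs_mult mult_right_mono)
  then have q: "\<bar>q\<bar> \<le> 1"
    using norm_mult_inv_dist_le[OF s, of x] by (simp add: k_def)
  have eqs: "inv_dist s x ^ (DIM('a) + 3) = K * k\<^sup>2" "inv_dist s x ^ (DIM('a) + 5) = K * k ^ 4"
    by (simp_all add: K_def k_def eval_nat_numeral algebra_simps)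
  have p2: "0 \<le> p\<^sup>2" "p\<^sup>2 \<le> 1" "0 \<le> p ^ 4" "p ^ 4 \<le> 1"
    using p by (auto intro: power_le_one)
  have q2: "0 \<le> q\<^sup>2" "q\<^sup>2 \<le> 1" using q by (auto simp: abs_square_le_1)
  have c: "c = (n + 1) * (n + 6)" by (simp add: c_def n_def)
  have two_terms: "\<bar>A * u - B * v\<bar> \<le> A + B"
    if "0 \<le> A" "0 \<le> B" "\<bar>u\<bar> \<le> 1" "\<bar>v\<bar> \<le> 1" for A B u v :: real
  proof -
    have "\<bar>A * u\<bar> \<le> A * 1" "\<bar>B * v\<bar> \<le> B * 1"
      using that by (simp_all only: abs_mult abs_of_nonneg mult_left_mono)
    then show ?thesis by linarith
  qed
  have coeffs: "1 + (n + 1) \<le> c" "(n + 1) * (n + 3) + 3 * (n + 1) \<le> c"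
      "(n + 1) * (n + 3) + (n + 1) \<le> c" "(n + 1) + 0 \<le> c"
    using n by (auto simp: c algebra_simps)
  note bound = order_trans[OF two_terms, THEN mult_right_mono[OF _ K]]
  show "\<bar>poisson s x\<bar> \<le> s * inv_dist s x ^ (DIM('a) + 1)"
    using s K by (simp add: poisson_def abs_mult K_def del: power_Suc)
  have "poisson_ds s x = (1 * 1 - (n + 1) * p\<^sup>2) * K"
    unfolding poisson_ds_def eqs K_def[symmetric] n_def[symmetric]
    by (simp add: p_def power2_eq_square algebra_simps)
  then show "\<bar>poisson_ds s x\<bar> \<le> c * inv_dist s x ^ (DIM('a) + 1)"
    unfolding K_def[symmetric]
    using bound[OF _ _ _ _ coeffs(1), of 1 "p\<^sup>2"] n p2 K
    by (simp add: abs_mult)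
  have "poisson_dss s x = ((n + 1) * (n + 3) * p ^ 4 - 3 * (n + 1) * p\<^sup>2) * K / s"
    unfolding poisson_dss_def eqs n_def[symmetric] using s
    by (simp add: p_def eval_nat_numeral field_simps)
  then show "\<bar>poisson_dss s x\<bar> \<le> c / s * inv_dist s x ^ (DIM('a) + 1)"
    unfolding K_def[symmetric]
    using bound[OF _ _ _ _ coeffs(2), of "p ^ 4" "p\<^sup>2"] n p2 K s
    by (simp add: abs_mult divide_right_mono)
  have "poisson_dx s b x = ((n + 1) * (- p * q) - 0 * 0) * K"
    unfolding poisson_dx_def eqs n_def[symmetric]
    by (simp add: p_def q_def power2_eq_square algebra_simps)
  then show "\<bar>poisson_dx s b x\<bar> \<le> c * inv_dist s x ^ (DIM('a) + 1)"
    unfolding K_def[symmetric]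
    using bound[OF _ _ _ _ coeffs(4), of "- p * q" 0] n p q K mult_mono[of "\<bar>p\<bar>" 1 "\<bar>q\<bar>" 1]
    by (simp add: abs_mult)
  have "poisson_dxx s b x = ((n + 1) * (n + 3) * (p\<^sup>2 * q\<^sup>2) - (n + 1) * p\<^sup>2) * K / s"
    unfolding poisson_dxx_def eqs n_def[symmetric] using s
    by (simp add: p_def q_def eval_nat_numeral field_simps)
  then show "\<bar>poisson_dxx s b x\<bar> \<le> c / s * inv_dist s x ^ (DIM('a) + 1)"
    unfolding K_def[symmetric]
    using bound[OF _ _ _ _ coeffs(3), of "p\<^sup>2 * q\<^sup>2" "p\<^sup>2"] n p2 q2 K s
      mult_mono[of "p\<^sup>2" 1 "q\<^sup>2" 1]
    by (simp add: abs_mult divide_right_mono)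
qed

section \<open>The half Laplacian of the Poisson kernel\<close>
lemma norm_exp_minus_ii_of_real [simp]: "norm (exp (- (\<i> * complex_of_real a))) = 1"
  by (metis mult_minus_right norm_exp_i_times of_real_minus)

lemma integrable_fourier:
  assumes "integrable lborel h"
  shows "integrable lborel (\<lambda>x. exp (- \<i> * of_real (x \<bullet> \<xi>)) * h x)"
proof (rule Bochner_Integration.integrable_bound[OF assms])
  have [measurable]: "h \<in> borel_measurable borel"
    using borel_measurable_integrable[OF assms] by simp
  show "(\<lambda>x. exp (- \<i> * of_real (x \<bullet> \<xi>)) * h x) \<in> borel_measurable lborel"
    by measurable
qed (simp add: norm_mult)

text \<open>A translation of \<open>h\<close> by \<open>t b\<close> multiplies its Fourier transform by \<open>exp (i t (b \<bullet> \<xi>))\<close>. The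
  claim is the derivative of this identity at \<open>t = 0\<close>.\<close>
lemma fourier_directional_derivative:
  fixes h h' :: "real ^ 'n \<Rightarrow> real"
  assumes h: "integrable lborel h"
    and der: "\<And>x t. ((\<lambda>t. h (x + t *\<^sub>R b)) has_real_derivative h' (x + t *\<^sub>R b)) (at t)"
    and bound: "\<And>x t. \<bar>t\<bar> < 1 \<Longrightarrow> \<bar>h' (x + t *\<^sub>R b)\<bar> \<le> w x"
    and w: "integrable lborel w"
  shows "integrable lborel h'"
    and "fourier (\<lambda>x. of_real (h' x)) \<xi> = \<i> * of_real (b \<bullet> \<xi>) * fourier (\<lambda>x. of_real (h x)) \<xi>"
proof -
  have [measurable]: "h \<in> borel_measurable borel"
    using borel_measurable_integrable[OF h] by simp
  let ?e = "\<lambda>x. exp (- \<i> * complex_of_real (x \<bullet> \<xi>))"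
  let ?F = "\<lambda>t x. ?e x * of_real (h (x + t *\<^sub>R b))"
  let ?F' = "\<lambda>t x. ?e x * of_real (h' (x + t *\<^sub>R b))"
  have int_t: "integrable lborel (\<lambda>x. h (x + t *\<^sub>R b))" for t
    using h by (subst lborel_translation) auto
  have F_int: "integrable lborel (?F t)" for t
    using integrable_of_real[OF int_t[of t]] by (rule integrable_fourier)
  have F_der: "((\<lambda>t. ?F t x) has_vector_derivative ?F' t x) (at t)" for t x
    using der[of x t]
    by (intro has_vector_derivative_mult_right has_vector_derivative_of_real)
       (simp add: has_real_derivative_iff_has_vector_derivative)
  have F_bound: "norm (?F' t x) \<le> w x" if "\<bar>t - 0\<bar> < 1" for t x
    using bound[of t x] that by (simp add: norm_mult)
  have shift: "(LINT x|lborel. ?F t x) = exp (\<i> * of_real (t * (b \<bullet> \<xi>))) * fourier (\<lambda>x. of_real (h x)) \<xi>" for t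
  proof -
    have "(LINT x|lborel. ?F t x) =
        (LINT x|lborel. exp (\<i> * of_real (t * (b \<bullet> \<xi>))) * (?e (x + t *\<^sub>R b) * of_real (h (x + t *\<^sub>R b))))"
      by (rule Bochner_Integration.integral_cong)
         (auto simp: inner_simps algebra_simps simp flip: exp_add)
    also have "\<dots> = exp (\<i> * of_real (t * (b \<bullet> \<xi>))) * (LINT x|lborel. ?e (x + t *\<^sub>R b) * of_real (h (x + t *\<^sub>R b)))"
      by simp
    also have "(LINT x|lborel. ?e (x + t *\<^sub>R b) * of_real (h (x + t *\<^sub>R b))) = fourier (\<lambda>x. of_real (h x)) \<xi>"
      unfolding fourier_def
      using lborel_translation(1)[of "\<lambda>x. ?e x * of_real (h x)" "t *\<^sub>R b"] by measurable
    finally show ?thesis .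
  qed
  have "integrable lborel (?F' 0)"
    by (rule has_vector_derivative_integral(1)[OF zero_less_one F_int F_der F_bound w])
  then have "integrable lborel (\<lambda>x. exp (- \<i> * complex_of_real (x \<bullet> (- \<xi>))) * ?F' 0 x)"
    by (rule integrable_fourier)
  then have "integrable lborel (\<lambda>x. complex_of_real (h' x))"
    by (simp add: exp_minus flip: mult.assoc)
  from integrable_Re[OF this] show "integrable lborel h'" by simp
  have "((\<lambda>t. LINT x|lborel. ?F t x) has_vector_derivative (LINT x|lborel. ?F' 0 x)) (at 0)"
    by (rule has_vector_derivative_integral(2)[OF zero_less_one F_int F_der F_bound w])
  moreover have "((\<lambda>t. LINT x|lborel. ?F t x) has_vector_derivative
      \<i> * of_real (b \<bullet> \<xi>) * fourier (\<lambda>x. of_real (h x)) \<xi>) (at 0)"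
  proof -
    have "((\<lambda>z. exp (\<i> * (z * of_real (b \<bullet> \<xi>))) * fourier (\<lambda>x. of_real (h x)) \<xi>)
        has_field_derivative \<i> * of_real (b \<bullet> \<xi>) * fourier (\<lambda>x. of_real (h x)) \<xi>) (at (of_real 0))"
      by (auto intro!: derivative_eq_intros)
    from has_vector_derivative_real_field[OF this] show ?thesis
      unfolding shift by simp
  qed
  ultimately have "(LINT x|lborel. ?F' 0 x) = \<i> * of_real (b \<bullet> \<xi>) * fourier (\<lambda>x. of_real (h x)) \<xi>"
    by (rule vector_derivative_unique_at)
  then show "fourier (\<lambda>x. of_real (h' x)) \<xi> = \<i> * of_real (b \<bullet> \<xi>) * fourier (\<lambda>x. of_real (h x)) \<xi>"
    by (simp add: fourier_def)
qed

lemma has_vector_derivative_fourier: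
  fixes h h' :: "real \<Rightarrow> real ^ 'n \<Rightarrow> real"
  assumes "d > 0"
    and "\<And>t. \<bar>t - s\<bar> < d \<Longrightarrow> integrable lborel (h t)"
    and der: "\<And>x t. \<bar>t - s\<bar> < d \<Longrightarrow> ((\<lambda>t. h t x) has_real_derivative h' t x) (at t)"
    and bound: "\<And>x t. \<bar>t - s\<bar> < d \<Longrightarrow> \<bar>h' t x\<bar> \<le> w x"
    and w: "integrable lborel w"
  shows "((\<lambda>t. fourier (\<lambda>x. of_real (h t x)) \<xi>) has_vector_derivative
    fourier (\<lambda>x. of_real (h' s x)) \<xi>) (at s)"
  unfolding fourier_def
proof (rule has_vector_derivative_integral(2)[OF assms(1) _ _ _ w])
  fix t assume t: "\<bar>t - s\<bar> < d"
  show "integrable lborel (\<lambda>x. exp (- \<i> * of_real (x \<bullet> \<xi>)) * complex_of_real (h t x))"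
    by (intro integrable_fourier integrable_of_real assms(2) t)
  fix x
  show "((\<lambda>t. exp (- \<i> * of_real (x \<bullet> \<xi>)) * complex_of_real (h t x)) has_vector_derivative
      exp (- \<i> * of_real (x \<bullet> \<xi>)) * complex_of_real (h' t x)) (at t)"
    using der[OF t, of x]
    by (intro has_vector_derivative_mult_right has_vector_derivative_of_real)
       (simp add: has_real_derivative_iff_has_vector_derivative)
  show "norm (exp (- \<i> * of_real (x \<bullet> \<xi>)) * complex_of_real (h' t x)) \<le> w x"
    using bound[OF t, of x] by (simp add: norm_mult)
qed

lemma norm_fourier_le:
  assumes "integrable lborel h"
  shows "norm (fourier h \<xi>) \<le> (LINT x|lborel. norm (h x))"
  unfolding fourier_def
  by (rule order_trans[OF integral_norm_bound]) (simp add: norm_mult)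

lemma fourier_sum:
  assumes "\<And>i. i \<in> I \<Longrightarrow> integrable lborel (h i)"
  shows "fourier (\<lambda>x. \<Sum>i\<in>I. h i x) \<xi> = (\<Sum>i\<in>I. fourier (h i) \<xi>)"
  unfolding fourier_def sum_distrib_left
  by (rule Bochner_Integration.integral_sum) (intro integrable_fourier assms)

lemma integrable_poisson:
  assumes s: "s > 0"
  shows "integrable lborel (poisson s :: 'a::euclidean_space \<Rightarrow> real)"
    and "integrable lborel (poisson_ds s :: 'a::euclidean_space \<Rightarrow> real)"
proof -
  have *: "integrable lborel h"
    if "h \<in> borel_measurable lborel" "\<And>x. \<bar>h x\<bar> \<le> c * inv_dist s x ^ (DIM('a) + 1)"
    for h :: "'a \<Rightarrow> real" and c
    using that(1) integrable_mult_right[OF integrable_inv_dist_power[OF s, where 'a='a], of c]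
  proof (rule_tac Bochner_Integration.integrable_bound)
    show "AE x in lborel. norm (h x) \<le> norm (c * inv_dist s x ^ (DIM('a) + 1))"
      unfolding real_norm_def by (rule AE_I2) (rule order_trans[OF that(2) abs_ge_self])
  qed
  obtain b :: 'a where b: "norm b = 1" using vector_choose_size[of 1] by auto
  show "integrable lborel (poisson s :: 'a \<Rightarrow> real)"
    "integrable lborel (poisson_ds s :: 'a \<Rightarrow> real)"
    by (rule *; use poisson_bounds[OF s b] in measurable)+
qed

lemma fourier_poisson_dxx:
  fixes b \<xi> :: "real ^ 'n"
  assumes s: "s > 0" and b: "norm b = 1"
  shows "integrable lborel (poisson_dxx s b)"
    and "fourier (\<lambda>x. of_real (poisson_dxx s b x)) \<xi> =
       - of_real ((b \<bullet> \<xi>)\<^sup>2) * fourier (\<lambda>x. of_real (poisson s x)) \<xi>"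
proof -
  let ?m = "DIM(real ^ 'n) + 1"
  define c where "c = (real DIM(real ^ 'n) + 1) * (real DIM(real ^ 'n) + 6)"
  have c: "c \<ge> 0" by (simp add: c_def)
  have near: "inv_dist s (x + t *\<^sub>R b) ^ ?m \<le> (2 + inverse s) ^ ?m * inv_dist s x ^ ?m"
    if "\<bar>t\<bar> < 1" for x t
    unfolding power_mult_distrib[symmetric]
    by (intro power_mono inv_dist_perturb s inv_dist_nonneg) (use that b in simp)
  have w: "integrable lborel (\<lambda>x::real ^ 'n. C * ((2 + inverse s) ^ ?m * inv_dist s x ^ ?m))" for C
    by (intro integrable_mult_right integrable_inv_dist_power s)
  have bound: "\<bar>poisson_dx s b (x + t *\<^sub>R b)\<bar> \<le> c * ((2 + inverse s) ^ ?m * inv_dist s x ^ ?m)"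
    "\<bar>poisson_dxx s b (x + t *\<^sub>R b)\<bar> \<le> c / s * ((2 + inverse s) ^ ?m * inv_dist s x ^ ?m)"
    if "\<bar>t\<bar> < 1" for x t
    using poisson_bounds(4,5)[OF s b, of "x + t *\<^sub>R b"] mult_left_mono[OF near[OF that, of x], of c]
      mult_left_mono[OF near[OF that, of x], of "c / s"] s c
    unfolding c_def[symmetric] by (meson order_trans divide_nonneg_pos)+
  note d1 = fourier_directional_derivative[OF integrable_poisson(1)[OF s] poisson_derivatives_line(1)[OF s b]
      bound(1) w]
  note d2 = fourier_directional_derivative[OF d1(1) poisson_derivatives_line(2)[OF s b] bound(2) w]
  show "integrable lborel (poisson_dxx s b)"
    by (rule d2(1))
  show "fourier (\<lambda>x. of_real (poisson_dxx s b x)) \<xi> =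
       - of_real ((b \<bullet> \<xi>)\<^sup>2) * fourier (\<lambda>x. of_real (poisson s x)) \<xi>"
    using d2(2)[of \<xi>] d1(2)[of \<xi>] by (simp add: power2_eq_square algebra_simps)
qed

text \<open>As the kernel is harmonic, its second derivative in \<open>s\<close> is minus its Laplacian in \<open>x\<close>,
  and the Fourier transform turns the Laplacian into multiplication by \<open>- \<bar>\<xi>\<bar>\<^sup>2\<close>.\<close>
lemma fourier_poisson_dss:
  fixes \<xi> :: "real ^ 'n"
  assumes s: "s > 0"
  shows "fourier (\<lambda>x. of_real (poisson_dss s x)) \<xi> =
    of_real ((norm \<xi>)\<^sup>2) * fourier (\<lambda>x. of_real (poisson s x)) \<xi>"
proof -
  have "(\<lambda>x. complex_of_real (poisson_dss s x)) =
      (\<lambda>x::real^'n. \<Sum>b\<in>Basis. - complex_of_real (poisson_dxx s b x))"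
    using poisson_harmonic[OF s]
    by (auto simp: fun_eq_iff sum_negf eq_neg_iff_add_eq_0 simp flip: of_real_sum of_real_minus)
  then have "fourier (\<lambda>x. of_real (poisson_dss s x)) \<xi> =
      (\<Sum>b\<in>Basis. fourier (\<lambda>x. - complex_of_real (poisson_dxx s b x)) \<xi>)"
  proof (simp only:, intro fourier_sum Bochner_Integration.integrable_minus integrable_of_real)
    fix b :: "real ^ 'n" assume "b \<in> Basis"
    then show "integrable lborel (poisson_dxx s b)"
      by (intro fourier_poisson_dxx(1)[OF s]) simp
  qed
  also have "\<dots> = (\<Sum>b\<in>Basis. of_real ((\<xi> \<bullet> b)\<^sup>2) * fourier (\<lambda>x. of_real (poisson s x)) \<xi>)"
  proof (rule sum.cong[OF refl])
    fix b :: "real ^ 'n" assume "b \<in> Basis"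
    then have b: "norm b = 1" by simp
    have "fourier (\<lambda>x. - complex_of_real (poisson_dxx s b x)) \<xi> =
        - fourier (\<lambda>x. complex_of_real (poisson_dxx s b x)) \<xi>"
      by (simp add: fourier_def)
    then show "fourier (\<lambda>x. - complex_of_real (poisson_dxx s b x)) \<xi> =
        of_real ((\<xi> \<bullet> b)\<^sup>2) * fourier (\<lambda>x. of_real (poisson s x)) \<xi>"
      using fourier_poisson_dxx(2)[OF s b, of \<xi>] by (simp add: inner_commute)
  qed
  also have "\<dots> = of_real (\<Sum>b\<in>Basis. (\<xi> \<bullet> b)\<^sup>2) * fourier (\<lambda>x. of_real (poisson s x)) \<xi>"
    by (simp add: sum_distrib_right)
  also have "(\<Sum>b\<in>Basis. (\<xi> \<bullet> b)\<^sup>2) = (norm \<xi>)\<^sup>2"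
    unfolding power2_norm_eq_inner using euclidean_inner[of \<xi> \<xi>] by (simp add: power2_eq_square)
  finally show ?thesis .
qed

text \<open>For fixed \<open>\<xi>\<close> the Fourier transform \<open>F(s)\<close> of the Poisson kernel satisfies
  \<open>F'' = \<bar>\<xi>\<bar>\<^sup>2 F\<close>. Hence \<open>exp (- \<bar>\<xi>\<bar> s) (F' + \<bar>\<xi>\<bar> F)\<close> is constant in \<open>s\<close>. It tends to \<open>0\<close> as
  \<open>s \<rightarrow> \<infinity>\<close>, since the \<open>L\<^sup>1\<close> norm of the kernel is constant and that of its \<open>s\<close>-derivative is of order
  \<open>1 / s\<close>. Thus \<open>F' = - \<bar>\<xi>\<bar> F\<close>, for \<open>\<xi> = 0\<close> as well.\<close>
lemma fourier_poisson_ds: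
  fixes \<xi> :: "real ^ 'n"
  assumes s0: "s0 > 0"
  shows "fourier (\<lambda>x. - of_real (poisson_ds s0 x)) \<xi> =
    of_real (norm \<xi>) * fourier (\<lambda>x. of_real (poisson s0 x)) \<xi>"
proof -
  let ?m = "DIM(real ^ 'n) + 1"
  define F where "F s = fourier (\<lambda>x. of_real (poisson s x)) \<xi>" for s
  define F1 where "F1 s = fourier (\<lambda>x. of_real (poisson_ds s x)) \<xi>" for s
  define a where "a = norm \<xi>"
  define c where "c = (real DIM(real ^ 'n) + 1) * (real DIM(real ^ 'n) + 6)"
  have a: "a \<ge> 0" and c: "c \<ge> 0" by (auto simp: a_def c_def)
  obtain b :: "real ^ 'n" where b: "norm b = 1" using vector_choose_size[of 1] by auto
  have mono: "inv_dist t x ^ ?m \<le> inv_dist (s / 2) x ^ ?m" if "\<bar>t - s\<bar> < s / 2"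
    for s t and x :: "real ^ 'n"
  proof (intro power_mono inv_dist_antimono inv_dist_nonneg)
    show "0 < s / 2" "s / 2 \<le> t" using that by arith+
  qed
  have dF: "(F has_vector_derivative F1 s) (at s)" if s: "s > 0" for s
    unfolding F_def F1_def
  proof (rule has_vector_derivative_fourier[where d="s / 2" and w = "\<lambda>x. c * inv_dist (s / 2) x ^ ?m"])
    fix t and x :: "real ^ 'n" assume t: "\<bar>t - s\<bar> < s / 2"
    then have t0: "t > 0" by (auto simp: abs_if split: if_splits)
    show "((\<lambda>t. poisson t x) has_real_derivative poisson_ds t x) (at t)"
      by (rule poisson_derivatives(1)[OF t0])
    show "\<bar>poisson_ds t x\<bar> \<le> c * inv_dist (s / 2) x ^ ?m"
      using poisson_bounds(2)[OF t0 b, of x] mult_left_mono[OF mono[OF t, of x] c]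
      unfolding c_def[symmetric] by linarith
    show "integrable lborel (poisson t :: real ^ 'n \<Rightarrow> real)"
      by (rule integrable_poisson[OF t0])
  next
    show "integrable lborel (\<lambda>x::real ^ 'n. c * inv_dist (s / 2) x ^ ?m)"
      by (rule integrable_mult_right, rule integrable_inv_dist_power) (use s in simp)
  qed (use s in simp)
  have dF1: "(F1 has_vector_derivative of_real (a\<^sup>2) * F s) (at s)" if s: "s > 0" for s
    unfolding F_def F1_def a_def fourier_poisson_dss[OF s, symmetric]
  proof (rule has_vector_derivative_fourier[where d="s / 2" and w = "\<lambda>x. c / (s / 2) * inv_dist (s / 2) x ^ ?m"])
    fix t and x :: "real ^ 'n" assume t: "\<bar>t - s\<bar> < s / 2"
    then have t0: "t > 0" and ts: "t \<ge> s / 2" by (auto simp: abs_if split: if_splits)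
    show "((\<lambda>t. poisson_ds t x) has_real_derivative poisson_dss t x) (at t)"
      by (rule poisson_derivatives(2)[OF t0])
    have "c / t * inv_dist t x ^ ?m \<le> c / (s / 2) * inv_dist (s / 2) x ^ ?m"
      by (intro mult_mono mono t divide_left_mono ts c divide_nonneg_pos zero_le_power inv_dist_nonneg)
         (use s t0 in auto)
    then show "\<bar>poisson_dss t x\<bar> \<le> c / (s / 2) * inv_dist (s / 2) x ^ ?m"
      using poisson_bounds(3)[OF t0 b, of x] unfolding c_def[symmetric] by linarith
    show "integrable lborel (poisson_ds t :: real ^ 'n \<Rightarrow> real)"
      by (rule integrable_poisson[OF t0])
  next
    show "integrable lborel (\<lambda>x::real ^ 'n. c / (s / 2) * inv_dist (s / 2) x ^ ?m)"
      by (rule integrable_mult_right, rule integrable_inv_dist_power) (use s in simp)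
  qed (use s in simp)
  define H where "H s = of_real (exp (- (a * s))) * (F1 s + of_real a * F s)" for s
  have dH: "(H has_vector_derivative 0) (at s)" if s: "s > 0" for s
  proof -
    have "((\<lambda>s. complex_of_real (exp (- (a * s)))) has_vector_derivative of_real (- a * exp (- (a * s)))) (at s)"
      by (rule has_vector_derivative_of_real)
         (auto intro!: derivative_eq_intros simp flip: has_real_derivative_iff_has_vector_derivative)
    from has_vector_derivative_mult[OF this
        has_vector_derivative_add[OF dF1[OF s] has_vector_derivative_mult_right[OF dF[OF s], of "of_real a"]]]
    show ?thesis
      unfolding H_def by (rule has_vector_derivative_eq_rhs) (simp add: power2_eq_square algebra_simps)
  qed
  have H_const: "H s = H s0" if s: "s > 0" for s
  proof -
    have "(H has_derivative (\<lambda>_. 0)) (at t within {0<..})" if "t \<in> {0<..}" for t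
      using dH[of t] that by (auto simp: has_vector_derivative_def intro: has_derivative_at_withinI)
    from has_derivative_zero_constant[OF _ this] obtain k where "\<And>t. t \<in> {0<..} \<Longrightarrow> H t = k"
      by (metis convex_real_interval(3))
    then show ?thesis using s s0 by simp
  qed
  define K where "K = (LINT x|lborel. inv_dist 1 (x :: real ^ 'n) ^ ?m)"
  have K: "K \<ge> 0" unfolding K_def by (intro integral_nonneg_AE) (simp add: inv_dist_nonneg)
  have H_le: "norm (H s0) \<le> (c * K + K) / s" if s: "s > 0" for s
  proof -
    have int: "integrable lborel (\<lambda>x::real ^ 'n. inv_dist s x ^ ?m)"
      by (rule integrable_inv_dist_power[OF s])
    have nF: "norm (F s) \<le> K"
    proof -
      have "norm (F s) \<le> (LINT x|lborel. norm (complex_of_real (poisson s (x :: real ^ 'n))))"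
        unfolding F_def by (intro norm_fourier_le integrable_of_real integrable_poisson s)
      also have "\<dots> \<le> (LINT x|lborel. s * inv_dist s (x :: real ^ 'n) ^ ?m)"
        by (intro integral_mono integrable_norm integrable_of_real integrable_poisson s
             integrable_mult_right int) (use poisson_bounds(1)[OF s b] in simp)
      also have "\<dots> = K"
        using integral_inv_dist_power[OF s, where 'a="real ^ 'n"] s by (simp add: K_def)
      finally show ?thesis .
    qed
    have nF1: "norm (F1 s) \<le> c * K / s"
    proof -
      have "norm (F1 s) \<le> (LINT x|lborel. norm (complex_of_real (poisson_ds s (x :: real ^ 'n))))"
        unfolding F1_def by (intro norm_fourier_le integrable_of_real integrable_poisson s)
      also have "\<dots> \<le> (LINT x|lborel. c * inv_dist s (x :: real ^ 'n) ^ ?m)"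
        by (intro integral_mono integrable_norm integrable_of_real integrable_poisson s
             integrable_mult_right int) (use poisson_bounds(2)[OF s b] in \<open>simp add: c_def\<close>)
      also have "\<dots> = c * K / s"
        using integral_inv_dist_power[OF s, where 'a="real ^ 'n"] s by (simp add: K_def field_simps)
      finally show ?thesis .
    qed
    have "norm (H s) \<le> exp (- (a * s)) * (c * K / s + a * K)"
      unfolding H_def norm_mult
      using nF nF1 a by (intro mult_mono order_trans[OF norm_triangle_ineq] add_mono)
        (auto simp: norm_mult mult_left_mono)
    also have "\<dots> = exp (- (a * s)) * (c * K / s) + (a * s * exp (- (a * s))) * (K / s)"
      using s by (simp add: field_simps)
    also have "\<dots> \<le> 1 * (c * K / s) + 1 * (K / s)"
    proof (intro add_mono mult_right_mono)
      show "exp (- (a * s)) \<le> 1" using a s by simp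
      have "a * s \<le> exp (a * s)" using exp_ge_add_one_self[of "a * s"] by linarith
      then show "a * s * exp (- (a * s)) \<le> 1" by (simp add: exp_minus field_simps)
    qed (use c K s in auto)
    finally show ?thesis using H_const[OF s] by (simp add: add_divide_distrib)
  qed
  have "H s0 = 0"
  proof (rule ccontr)
    assume "H s0 \<noteq> 0"
    then have pos: "norm (H s0) > 0" by simp
    \<comment> \<open>A height at which \<open>H_le\<close> fails.\<close>
    define s where "s = (c * K + K + 1) / norm (H s0)"
    have cK: "0 \<le> c * K" using c K by simp
    have s: "s > 0" using pos cK K by (simp add: s_def)
    have "norm (H s0) * s \<le> c * K + K" using H_le[OF s] s by (simp add: field_simps)
    moreover have "norm (H s0) * s = c * K + K + 1" using pos by (simp add: s_def)
    ultimately show False by simp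
  qed
  then have "F1 s0 + of_real a * F s0 = 0" by (simp add: H_def)
  then have "- F1 s0 = of_real a * F s0"
    by (simp add: neg_eq_iff_add_eq_0)
  moreover have "fourier (\<lambda>x. - of_real (poisson_ds s0 x)) \<xi> = - F1 s0"
    by (simp add: F1_def fourier_def)
  ultimately show ?thesis by (simp add: a_def F_def)
qed

section \<open>Weights, layers and the pointwise estimate\<close>
definition bump :: "real \<Rightarrow> real" where
  "bump t = flat_exp 0 (1 - t\<^sup>2)"

definition bump' :: "real \<Rightarrow> real" where
  "bump' t = - 2 * t * flat_exp 2 (1 - t\<^sup>2)"

lemma bump_nonneg: "bump t \<ge> 0"
  by (simp add: bump_def flat_exp_nonneg)

lemma bump_le_1: "bump t \<le> 1"
  using flat_exp_le_fact[of 0] by (simp add: bump_def)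

lemma bump_eq_0: "\<bar>t\<bar> \<ge> 1 \<Longrightarrow> bump t = 0"
  unfolding bump_def by (rule flat_exp_eq_0) (simp add: abs_square_le_1 flip: abs_le_square_iff[of 1, simplified])

lemma bump_antimono:
  assumes "0 \<le> s" "s \<le> t"
  shows "bump t \<le> bump s"
proof -
  have "s\<^sup>2 \<le> t\<^sup>2" using assms by (intro power_mono)
  then show ?thesis
    by (auto simp: bump_def flat_exp_def intro!: le_imp_inverse_le)
qed

lemma has_real_derivative_bump: "(bump has_real_derivative bump' t) (at t)"
proof -
  have "((\<lambda>t. 1 - t\<^sup>2) has_real_derivative - 2 * t) (at t)"
    by (auto intro!: derivative_eq_intros)
  from DERIV_chain2[OF has_real_derivative_flat_exp[of 0] this] show ?thesis
    unfolding bump_def bump'_def by (rule DERIV_cong) (simp add: numeral_2_eq_2)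
qed

lemma abs_bump'_le: "\<bar>bump' t\<bar> \<le> 4"
proof (cases "\<bar>t\<bar> < 1")
  case True
  then have "\<bar>t\<bar> * flat_exp 2 (1 - t\<^sup>2) \<le> 1 * 2"
    using flat_exp_le_fact[of 2 "1 - t\<^sup>2"]
    by (intro mult_mono) (auto simp: flat_exp_nonneg numeral_2_eq_2)
  then show ?thesis by (simp add: bump'_def abs_mult flat_exp_nonneg)
next
  case False
  then have "1 - t\<^sup>2 \<le> 0" by (simp flip: abs_le_square_iff[of 1, simplified])
  then show ?thesis by (simp add: bump'_def flat_exp_eq_0)
qed

definition weight :: "nat \<Rightarrow> nat \<Rightarrow> nat \<Rightarrow> real" where
  "weight n J j = real (Suc J - j) ^ Suc n - real (J - j) ^ Suc n"

lemma weight_nonneg: "weight n J j \<ge> 0"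
  by (simp add: weight_def power_mono del: power_Suc)

text \<open>The weights are defined as differences, so their tails telescope.\<close>
lemma sum_weight:
  assumes "k \<le> J"
  shows "(\<Sum>j=k..J. weight n J j) = real (Suc J - k) ^ Suc n"
proof -
  have "(\<Sum>j=k..J. weight n J j) =
      - (\<Sum>j=k..J. real (Suc J - Suc j) ^ Suc n - real (Suc J - j) ^ Suc n)"
    by (simp add: weight_def flip: sum_negf)
  also have "\<dots> = real (Suc J - k) ^ Suc n - real (Suc J - Suc J) ^ Suc n"
    using assms by (subst sum_Suc_diff) (simp_all del: power_Suc)
  finally show ?thesis by simp
qed

text \<open>Bernoulli's inequality. The bound is the discrete form of \<open>w \<le> (n + 1) S\<^sup>1\<^sup>/\<^sup>p\<close> for the tails
  \<open>S\<close> of the weights, and this relation dictates their choice.\<close>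
lemma weight_le:
  assumes "j \<le> J"
  shows "weight n J j \<le> real (Suc n) * real (Suc J - j) ^ n"
proof -
  define a where "a = real (Suc J - j)"
  have a: "a \<ge> 1" and b: "real (J - j) = a - 1"
    using assms by (auto simp: a_def of_nat_diff)
  have "1 + real (Suc n) * (- inverse a) \<le> (1 + (- inverse a)) ^ Suc n"
    using a by (intro Bernoulli_inequality) (simp add: field_simps)
  then have "a ^ Suc n * (1 + real (Suc n) * (- inverse a)) \<le> a ^ Suc n * (1 + (- inverse a)) ^ Suc n"
    using a by (intro mult_left_mono) auto
  also have "\<dots> = (a - 1) ^ Suc n"
  proof -
    have "a * (1 + - inverse a) = a - 1" using a by (simp add: field_simps)
    then show ?thesis by (simp only: power_mult_distrib[symmetric])
  qed
  also have "a ^ Suc n * (1 + real (Suc n) * (- inverse a)) = a ^ Suc n - real (Suc n) * a ^ n"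
    using a by (simp add: field_simps)
  finally show ?thesis
    unfolding weight_def b a_def[symmetric] by simp
qed

text \<open>All summands with index at least \<open>k\<close> exceed the one with \<open>v k\<close>, and their weights add up to
  the tail. So a layer is bounded by the sum with a gain far better than its own weight.\<close>
lemma layer_le_weighted_sum:
  fixes v :: "nat \<Rightarrow> real"
  assumes v: "\<And>j. v j \<ge> 0" and mono: "\<And>j k. j \<le> k \<Longrightarrow> v j \<le> v k" and k: "k \<le> J"
  shows "(real (Suc J - k) * v k) ^ Suc n \<le> (\<Sum>j\<le>J. weight n J j * v j ^ Suc n)"
proof -
  have "(real (Suc J - k) * v k) ^ Suc n = (\<Sum>j=k..J. weight n J j * v k ^ Suc n)"
    by (simp only: power_mult_distrib sum_weight[OF k, symmetric] sum_distrib_right)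
  also have "\<dots> \<le> (\<Sum>j=k..J. weight n J j * v j ^ Suc n)"
    by (intro sum_mono mult_left_mono power_mono mono v weight_nonneg) auto
  also have "\<dots> \<le> (\<Sum>j\<le>J. weight n J j * v j ^ Suc n)"
    by (intro sum_mono2) (auto intro!: mult_nonneg_nonneg weight_nonneg v zero_le_power simp del: power_Suc)
  finally show ?thesis .
qed

lemma sum_inverse_powers_of_2_le:
  fixes M :: real
  assumes A: "finite A" and M: "M > 0" "\<And>j. j \<in> A \<Longrightarrow> M \<le> 2 ^ j"
  shows "(\<Sum>j\<in>A. inverse (2 ^ j)) \<le> 2 / M"
proof (cases "A = {}")
  case False
  define k where "k = Min A"
  have k: "k \<in> A" "\<And>j. j \<in> A \<Longrightarrow> k \<le> j"
    using A False by (auto simp: k_def)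
  have "(\<Sum>j\<in>A. inverse (2 ^ j)) \<le> (\<Sum>j\<in>{k..<Suc (Max A)}. inverse (2 ^ j :: real))"
    using A k by (intro sum_mono2) (auto simp: less_Suc_eq_le)
  also have "\<dots> \<le> 2 * inverse (2 ^ k)"
  proof -
    have "(\<Sum>j\<in>{k..<l}. inverse (2 ^ j :: real)) \<le> 2 * inverse (2 ^ k) - 2 * inverse (2 ^ l)"
      if "k \<le> l" for l
      using that by (induction l rule: dec_induct) auto
    from this[of "Suc (Max A)"] show ?thesis
      using A k by (smt (verit) Max_ge le_Suc_eq inverse_nonnegative_iff_nonnegative zero_le_power)
  qed
  also have "\<dots> \<le> 2 / M"
    using M(1) M(2)[OF k(1)] by (simp add: field_simps)
  finally show ?thesis .
qed (use M in simp)

lemma sum_arith_geometric_le: "(\<Sum>i\<le>k. (1 + real i) * inverse (2 ^ i)) \<le> 4"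
proof -
  have "(\<Sum>i\<le>k. (1 + real i) * inverse (2 ^ i)) = 4 - (3 + real k) * inverse (2 ^ k)"
    by (induction k) (simp_all add: field_simps)
  then show ?thesis by simp
qed

text \<open>The \<open>(n + 1)\<close>-st root of the contribution of the scale \<open>2\<^sup>j\<close> to the test function. It lies
  between \<open>0\<close> and \<open>1\<close>, and near the origin it is comparable to \<open>1\<close>. Starting from the root keeps all
  exponents natural numbers: the time derivative of its \<open>(n + 1)\<close>-st power retains the factor
  \<open>bump\<^sup>n\<close>, as is necessary near the end of the support.\<close>
definition layer :: "nat \<Rightarrow> real \<Rightarrow> 'a::euclidean_space \<Rightarrow> real" where
  "layer j t x = bump (t / 2 ^ j) * (2 ^ j * inv_dist (2 ^ j) x)"

lemma layer_nonneg: "layer j t x \<ge> 0"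
  by (simp add: layer_def bump_nonneg inv_dist_nonneg)

lemma layer_le_1: "layer j t x \<le> 1"
proof -
  have "layer j t x \<le> 1 * 1"
    unfolding layer_def
    by (intro mult_mono bump_le_1 inv_dist_mult_le bump_nonneg mult_nonneg_nonneg inv_dist_nonneg) auto
  then show ?thesis by simp
qed

lemma layer_measurable [measurable]: "layer j t \<in> borel_measurable borel"
  unfolding layer_def by (intro borel_measurable_times borel_measurable_const inv_dist_measurable)

lemma mult_inv_dist_mono:
  assumes "0 < r" "r \<le> s"
  shows "r * inv_dist r x \<le> s * inv_dist s x"
proof -
  have "norm (inverse s *\<^sub>R x) \<le> norm (inverse r *\<^sub>R x)"
    using assms by (auto intro!: mult_right_mono simp: field_simps)
  then have "inv_dist 1 (inverse r *\<^sub>R x) \<le> inv_dist 1 (inverse s *\<^sub>R x)"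
    unfolding inv_dist_def
    by (intro le_imp_inverse_le real_sqrt_le_mono add_left_mono power_mono) (auto simp: add_pos_nonneg)
  then show ?thesis
    using assms inv_dist_scale[of r x] inv_dist_scale[of s x] by (simp flip: mult.assoc)
qed

lemma layer_mono:
  assumes "t \<ge> 0" "j \<le> k"
  shows "layer j t x \<le> layer k t x"
  unfolding layer_def
proof (rule mult_mono)
  have p: "(2::real) ^ j \<le> 2 ^ k" using assms by simp
  show "bump (t / 2 ^ j) \<le> bump (t / 2 ^ k)"
    using assms p by (intro bump_antimono divide_left_mono) auto
  show "2 ^ j * inv_dist (2 ^ j) x \<le> 2 ^ k * inv_dist (2 ^ k) x"
    using p by (intro mult_inv_dist_mono) auto
qed (auto simp: bump_nonneg inv_dist_nonneg)

lemma layer_eq_0: "t \<ge> 2 ^ j \<Longrightarrow> layer j t x = 0"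
  by (simp add: layer_def bump_eq_0)

text \<open>Far outside the ball of radius \<open>2\<^sup>k\<close>, a layer with a small index is much smaller than the one
  with index \<open>k\<close>. Monotonicity alone would lose a power of \<open>J\<close> there.\<close>
lemma layer_decay:
  assumes t: "t \<ge> 0" and jk: "j \<le> k" and k: "2 ^ k \<le> norm x"
  shows "layer j t x \<le> 2 * inverse (2 ^ (k - j)) * layer k t x"
proof -
  define y where "y = norm x"
  have y: "y > 0" using less_le_trans[OF _ k, of 0] by (simp add: y_def)
  have "inv_dist (2 ^ j) x \<le> 1 / y"
    using norm_mult_inv_dist_le[of "2 ^ j" x] y by (simp add: field_simps y_def)
  have "sqrt ((2 ^ k)\<^sup>2 + y\<^sup>2) \<le> 2 ^ k + y"
    using y by (intro sqrt_sum_squares_le_sum) auto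
  also have "\<dots> \<le> 2 * y" using k by (simp add: y_def)
  finally have "1 / y \<le> 2 * inv_dist (2 ^ k) x"
    using y unfolding inv_dist_def y_def[symmetric]
    by (simp add: field_simps add_pos_pos)
  with \<open>inv_dist (2 ^ j) x \<le> 1 / y\<close> have "inv_dist (2 ^ j) x \<le> 2 * inv_dist (2 ^ k) x"
    by simp
  then have "2 ^ j * inv_dist (2 ^ j) x \<le> 2 * inverse (2 ^ (k - j)) * (2 ^ k * inv_dist (2 ^ k) x)"
    using jk by (simp add: power_diff field_simps)
  moreover have "bump (t / 2 ^ j) \<le> bump (t / 2 ^ k)"
    using t jk by (intro bump_antimono divide_left_mono) auto
  ultimately have "layer j t x \<le> bump (t / 2 ^ k) * (2 * inverse (2 ^ (k - j)) * (2 ^ k * inv_dist (2 ^ k) x))"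
    unfolding layer_def by (meson mult_mono bump_nonneg inv_dist_nonneg mult_nonneg_nonneg zero_le_numeral zero_le_power)
  then show ?thesis unfolding layer_def by (simp only: mult_ac)
qed

text \<open>By \<open>weight_le\<close> and \<open>layer_le_weighted_sum\<close> each summand is at most
  \<open>(n + 1) \<psi>\<^sup>n inv_dist (2\<^sup>j) x\<close>. With \<open>M = max 1 t \<bar>x\<bar>\<close>, the summands with \<open>2\<^sup>j \<ge> \<bar>x\<bar>\<close> vanish unless
  \<open>2\<^sup>j \<ge> M\<close>, and then they form a geometric series dominated by its first term, of order \<open>1 / M\<close>.
  Those with \<open>2\<^sup>j < \<bar>x\<bar>\<close> all have \<open>inv_dist (2\<^sup>j) x\<close> of order \<open>1 / \<bar>x\<bar>\<close>, and they are summable only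
  because of \<open>layer_decay\<close>: comparison with the largest such index \<open>k\<close> gives the factor
  \<open>(1 + (k - j)) 2\<^sup>-\<^sup>(\<^sup>k\<^sup>-\<^sup>j\<^sup>)\<close>, in which \<open>1 + (k - j)\<close> bounds \<open>(J + 1 - j) / (J + 1 - k)\<close>.\<close>
lemma layer_sum_estimate:
  fixes x :: "'a::euclidean_space"
  assumes n: "n \<ge> 1" and t: "t \<ge> 0"
    and \<psi>: "\<psi> \<ge> 0" "\<psi> ^ Suc n = (\<Sum>j\<le>J. weight n J j * layer j t x ^ Suc n)"
  shows "(\<Sum>j\<le>J. weight n J j * inv_dist (2 ^ j) x * layer j t x ^ n)
     \<le> 3 * real (Suc n) * (2 + 4 * 2 ^ n) * \<psi> ^ n * inverse (1 + t + norm x)"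
proof -
  define y where "y = norm x"
  define M where "M = max 1 (max t y)"
  define T where "T j = weight n J j * inv_dist (2 ^ j) x * layer j t x ^ n" for j
  have y: "y \<ge> 0" by (simp add: y_def)
  have M: "M \<ge> 1" "M > 0" by (auto simp: M_def)
  have peak: "real (Suc J - j) * layer j t x \<le> \<psi>" if "j \<le> J" for j
  proof -
    have "(real (Suc J - j) * layer j t x) ^ Suc n \<le> \<psi> ^ Suc n"
      unfolding \<psi>(2) using that t
      by (intro layer_le_weighted_sum layer_nonneg layer_mono) auto
    then show ?thesis by (rule power_le_imp_le_base) (rule \<psi>)
  qed
  have term_le: "T j \<le> real (Suc n) * inv_dist (2 ^ j) x * (real (Suc J - j) * layer j t x) ^ n"
    if "j \<le> J" for j
  proof -
    have "T j \<le> real (Suc n) * real (Suc J - j) ^ n * inv_dist (2 ^ j) x * layer j t x ^ n"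
      unfolding T_def using weight_le[OF that, of n]
      by (intro mult_right_mono) (auto simp: inv_dist_nonneg layer_nonneg)
    then show ?thesis by (simp only: power_mult_distrib mult_ac)
  qed
  have T0: "T j = 0" if "2 ^ j \<le> t" for j
    using layer_eq_0[OF that, of x] n by (simp add: T_def)
  \<comment> \<open>Scales above and below \<open>\<bar>x\<bar>\<close>.\<close>
  define H where "H = {j\<in>{..J}. y \<le> 2 ^ j}"
  define L where "L = {j\<in>{..J}. 2 ^ j < y}"
  have "sum T H \<le> (\<Sum>j\<in>{j\<in>H. M \<le> 2 ^ j}. real (Suc n) * \<psi> ^ n * inverse (2 ^ j))"
  proof -
    have "sum T H = sum T {j\<in>H. M \<le> 2 ^ j}"
    proof (rule sum.mono_neutral_right)
      show "\<forall>j\<in>H - {j \<in> H. M \<le> 2 ^ j}. T j = 0"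
      proof
        fix j assume "j \<in> H - {j \<in> H. M \<le> 2 ^ j}"
        then have "y \<le> 2 ^ j" "2 ^ j < M" by (auto simp: H_def)
        moreover have "(1::real) \<le> 2 ^ j" by simp
        ultimately have "2 ^ j \<le> t" unfolding M_def by linarith
        then show "T j = 0" by (rule T0)
      qed
    qed (auto simp: H_def)
    also have "\<dots> \<le> (\<Sum>j\<in>{j\<in>H. M \<le> 2 ^ j}. real (Suc n) * \<psi> ^ n * inverse (2 ^ j))"
    proof (rule sum_mono)
      fix j assume "j \<in> {j \<in> H. M \<le> 2 ^ j}"
      then have j: "j \<le> J" by (simp add: H_def)
      have "inv_dist (2 ^ j) x \<le> inverse (2 ^ j)"
        using inv_dist_mult_le[of "2 ^ j" x] by (simp add: field_simps)
      moreover have "(real (Suc J - j) * layer j t x) ^ n \<le> \<psi> ^ n"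
        by (intro power_mono peak j mult_nonneg_nonneg layer_nonneg) auto
      ultimately have "inv_dist (2 ^ j) x * (real (Suc J - j) * layer j t x) ^ n \<le> inverse (2 ^ j) * \<psi> ^ n"
        by (intro mult_mono) (auto simp: layer_nonneg inv_dist_nonneg)
      from mult_left_mono[OF this, of "real (Suc n)"] term_le[OF j]
      show "T j \<le> real (Suc n) * \<psi> ^ n * inverse (2 ^ j)"
        by (simp only: mult_ac) linarith
    qed
    finally show ?thesis .
  qed
  also have "\<dots> \<le> real (Suc n) * \<psi> ^ n * (2 / M)"
    unfolding sum_distrib_left[symmetric]
    by (intro mult_left_mono sum_inverse_powers_of_2_le M) (auto simp: H_def \<psi>)
  finally have high: "sum T H \<le> real (Suc n) * \<psi> ^ n * (2 / M)" .
  have low: "sum T L \<le> real (Suc n) * \<psi> ^ n * (4 * 2 ^ n / M)"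
  proof (cases "L = {}")
    case False
    define k where "k = Max L"
    have finL: "finite L" by (simp add: L_def)
    have k: "k \<in> L" "\<And>j. j \<in> L \<Longrightarrow> j \<le> k"
      using False finL by (auto simp: k_def)
    then have kJ: "k \<le> J" and ky: "2 ^ k \<le> norm x" by (auto simp: L_def y_def)
    have "sum T L \<le> (\<Sum>j\<in>L. real (Suc n) * \<psi> ^ n * 2 ^ n / M * ((1 + real (k - j)) * inverse (2 ^ (k - j))))"
    proof (rule sum_mono)
      fix j assume jL: "j \<in> L"
      then have j: "j \<le> J" "2 ^ j < y" "j \<le> k" using k by (auto simp: L_def)
      define i where "i = k - j"
      have rhs: "0 \<le> real (Suc n) * \<psi> ^ n * 2 ^ n / M * ((1 + real i) * inverse (2 ^ i))"
        using \<psi> M by simp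
      show "T j \<le> real (Suc n) * \<psi> ^ n * 2 ^ n / M * ((1 + real (k - j)) * inverse (2 ^ (k - j)))"
      proof (cases "2 ^ j \<le> t")
        case True
        then show ?thesis using rhs T0 by (simp add: i_def)
      next
        case False
        have y1: "y > 1" using j(2) one_le_power[of "2::real" j] by linarith
        then have My: "M = y" using False j(2) by (auto simp: M_def max_def)
        have inv: "inv_dist (2 ^ j) x \<le> 1 / M"
          using norm_mult_inv_dist_le[of "2 ^ j" x] y1 unfolding My
          by (simp add: pos_le_divide_eq y_def[symmetric] mult.commute[of y])
        have "real (Suc J - j) * layer j t x \<le>
            (real (Suc J - k) * (1 + real i)) * (2 * inverse (2 ^ i) * layer k t x)"
        proof (intro mult_mono layer_nonneg)
          have "real i \<le> real (Suc J - k) * real i"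
            using kJ by (simp add: mult_le_cancel_right1)
          moreover have "real (Suc J - j) = real (Suc J - k) + real i"
            using kJ j by (simp add: i_def of_nat_diff)
          ultimately show "real (Suc J - j) \<le> real (Suc J - k) * (1 + real i)"
            by (simp add: distrib_left)
          show "layer j t x \<le> 2 * inverse (2 ^ i) * layer k t x"
            unfolding i_def by (rule layer_decay[OF t j(3) ky])
        qed auto
        also have "\<dots> = (2 * ((1 + real i) * inverse (2 ^ i))) * (real (Suc J - k) * layer k t x)"
          by (simp only: mult_ac)
        also have "\<dots> \<le> (2 * ((1 + real i) * inverse (2 ^ i))) * \<psi>"
          by (intro mult_left_mono peak kJ) auto
        finally have "(real (Suc J - j) * layer j t x) ^ n \<le> ((2 * ((1 + real i) * inverse (2 ^ i))) * \<psi>) ^ n"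
          by (intro power_mono mult_nonneg_nonneg layer_nonneg) auto
        also have "\<dots> = 2 ^ n * ((1 + real i) * inverse (2 ^ i)) ^ n * \<psi> ^ n"
          by (simp only: power_mult_distrib)
        also have "\<dots> \<le> 2 ^ n * ((1 + real i) * inverse (2 ^ i)) * \<psi> ^ n"
        proof (intro mult_right_mono mult_left_mono)
          have "1 + real l \<le> 2 ^ l" for l
          proof (induction l)
            case (Suc l)
            then show ?case using one_le_power[of "2::real" l] by simp
          qed simp
          then have "(1 + real i) * inverse (2 ^ i) \<le> 1" by (simp add: field_simps)
          then show "((1 + real i) * inverse (2 ^ i)) ^ n \<le> (1 + real i) * inverse (2 ^ i)"
            using power_decreasing[OF n, of "(1 + real i) * inverse (2 ^ i)"] by simp
        qed (use \<psi> in auto)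
        finally have "inv_dist (2 ^ j) x * (real (Suc J - j) * layer j t x) ^ n \<le>
            1 / M * (2 ^ n * ((1 + real i) * inverse (2 ^ i)) * \<psi> ^ n)"
          using inv by (intro mult_mono) (auto simp: layer_nonneg M intro!: less_imp_le[OF M(2)])
        from mult_left_mono[OF this, of "real (Suc n)"] term_le[OF j(1)]
        show ?thesis unfolding i_def by (simp add: mult_ac)
      qed
    qed
    also have "\<dots> \<le> (\<Sum>j\<in>{..k}. real (Suc n) * \<psi> ^ n * 2 ^ n / M * ((1 + real (k - j)) * inverse (2 ^ (k - j))))"
      using k \<psi> M by (intro sum_mono2) auto
    also have "\<dots> = real (Suc n) * \<psi> ^ n * 2 ^ n / M * (\<Sum>i\<le>k. (1 + real i) * inverse (2 ^ i))"
      unfolding sum_distrib_left[symmetric]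
      by (subst sum.atLeastAtMost_rev[of "\<lambda>i. (1 + real i) * inverse (2 ^ i)" 0 k, unfolded atLeast0AtMost]) simp
    also have "\<dots> \<le> real (Suc n) * \<psi> ^ n * 2 ^ n / M * 4"
      using \<psi> M by (intro mult_left_mono sum_arith_geometric_le) auto
    finally show ?thesis by (simp add: mult_ac)
  qed (use \<psi> M in simp)
  have "(\<Sum>j\<le>J. T j) = sum T (H \<union> L)"
    by (rule sum.cong) (auto simp: H_def L_def)
  also have "\<dots> = sum T H + sum T L"
    by (rule sum.union_disjoint) (auto simp: H_def L_def)
  also have "\<dots> \<le> real (Suc n) * \<psi> ^ n * (2 / M) + real (Suc n) * \<psi> ^ n * (4 * 2 ^ n / M)"
    using high low by linarith
  also have "\<dots> = (real (Suc n) * (2 + 4 * 2 ^ n) * \<psi> ^ n) * (1 / M)"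
    using M by (simp add: field_simps)
  also have "\<dots> \<le> (real (Suc n) * (2 + 4 * 2 ^ n) * \<psi> ^ n) * (3 * inverse (1 + t + y))"
  proof (intro mult_left_mono)
    have "1 + t + y \<le> 3 * M" by (auto simp: M_def)
    then show "1 / M \<le> 3 * inverse (1 + t + y)"
      using M t y by (simp add: field_simps)
  qed (use \<psi> in auto)
  finally show ?thesis unfolding T_def y_def by (simp only: mult_ac)
qed

section \<open>The test function\<close>
lemma L1_Linf_separable:
  fixes A :: "real \<Rightarrow> real" and B :: "real ^ 'n \<Rightarrow> real"
  assumes A [measurable]: "A \<in> borel_measurable borel" and A_le: "\<And>t. \<bar>A t\<bar> \<le> a"
    and A0: "\<And>t. \<bar>t\<bar> > R \<Longrightarrow> A t = 0"
    and B: "integrable lborel B" and B_le: "\<And>x. \<bar>B x\<bar> \<le> b"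
  shows "L1_Linf (\<lambda>(t, x). complex_of_real (A t * B x))"
  unfolding L1_Linf_def
proof
  have [measurable]: "B \<in> borel_measurable borel"
    using borel_measurable_integrable[OF B] by simp
  have intA: "integrable lborel A"
  proof (rule integrableI_bounded_set[where A="{-R..R}" and B=a])
    show "AE x in lborel. x \<notin> {-R..R} \<longrightarrow> A x = 0"
      using A0 by (auto simp: abs_le_iff not_le[symmetric])
  qed (use A_le in \<open>auto simp: emeasure_lborel_Icc_eq\<close>)
  have "integrable (lborel \<Otimes>\<^sub>M lborel) (\<lambda>(t, x). complex_of_real (A t * B x))"
  proof (rule lborel_pair.Fubini_integrable)
    show "integrable lborel (\<lambda>t. LINT x|lborel. norm (case (t, x) of (t, x) \<Rightarrow> complex_of_real (A t * B x)))"
      using intA by (simp add: norm_mult abs_mult)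
    show "AE t in lborel. integrable lborel (\<lambda>x. case (t, x) of (t, x) \<Rightarrow> complex_of_real (A t * B x))"
      using B by (auto simp del: of_real_mult)
  qed measurable
  then show "integrable lborel (\<lambda>(t, x). complex_of_real (A t * B x))"
    by (simp add: lborel_prod)
  have "norm (case z of (t, x) \<Rightarrow> complex_of_real (A t * B x)) \<le> a * b" for z
  proof -
    have "a \<ge> 0" using A_le[of 0] by linarith
    then show ?thesis
      using mult_mono[OF A_le[of "fst z"] B_le[of "snd z"]]
      by (simp add: case_prod_unfold abs_mult norm_mult)
  qed
  then show "\<exists>M. AE z in lborel. norm (case z of (t, x) \<Rightarrow> complex_of_real (A t * B x)) \<le> M"
    by blast
qed

lemma L1_Linf_sum:
  assumes "finite I" "\<And>i. i \<in> I \<Longrightarrow> L1_Linf (h i)"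
  shows "L1_Linf (\<lambda>z. \<Sum>i\<in>I. h i z)"
  unfolding L1_Linf_def
proof
  show "integrable lborel (\<lambda>z. \<Sum>i\<in>I. h i z)"
    using assms by (intro Bochner_Integration.integrable_sum) (auto simp: L1_Linf_def)
  from assms have "\<forall>i\<in>I. \<exists>M. AE z in lborel. norm (h i z) \<le> M"
    by (auto simp: L1_Linf_def)
  then obtain M where "\<And>i. i \<in> I \<Longrightarrow> AE z in lborel. norm (h i z) \<le> M i"
    by metis
  then have "AE z in lborel. \<forall>i\<in>I. norm (h i z) \<le> M i"
    using assms(1) by (simp add: AE_finite_all)
  then have "AE z in lborel. norm (\<Sum>i\<in>I. h i z) \<le> (\<Sum>i\<in>I. M i)"
    by eventually_elim (auto intro: sum_norm_le)
  then show "\<exists>M. AE z in lborel. norm (\<Sum>i\<in>I. h i z) \<le> M" by blast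
qed

text \<open>The test function. For \<open>t \<ge> 0\<close> it is roughly of size \<open>(log\<^sub>2 (2\<^sup>J / r))\<^sup>n\<^sup>+\<^sup>1\<close> at distance \<open>r\<close>
  from the origin, as long as \<open>r\<close> is between \<open>1\<close> and a small multiple of \<open>2\<^sup>J\<close>.\<close>
definition log_profile :: "nat \<Rightarrow> real \<times> (real ^ 'n) \<Rightarrow> real" where
  "log_profile J = (\<lambda>(t, x). \<Sum>j\<le>J. weight CARD('n) J j * layer j t x ^ Suc CARD('n))"

definition log_profile_dt :: "nat \<Rightarrow> real \<times> (real ^ 'n) \<Rightarrow> real" where
  "log_profile_dt J = (\<lambda>(t, x). \<Sum>j\<le>J. weight CARD('n) J j *
     (real (Suc CARD('n)) * bump (t / 2 ^ j) ^ CARD('n) * bump' (t / 2 ^ j) / 2 ^ j) *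
     (2 ^ j * inv_dist (2 ^ j) x) ^ Suc CARD('n))"

definition log_profile_half_lap :: "nat \<Rightarrow> real \<times> (real ^ 'n) \<Rightarrow> real" where
  "log_profile_half_lap J = (\<lambda>(t, x). \<Sum>j\<le>J. weight CARD('n) J j *
     bump (t / 2 ^ j) ^ Suc CARD('n) * ((2 ^ j) ^ CARD('n) * - poisson_ds (2 ^ j) x))"

text \<open>The variables enter a layer only through terms of the right form: \<open>t\<close> and the coordinates of \<open>x\<close>
  are inner products with fixed vectors.\<close>
lemma smooth_term_layer:
  "smooth_term (\<lambda>z :: real \<times> (real ^ 'n). layer j (fst z) (snd z))"
proof -
  have "smooth_term (\<lambda>z :: real \<times> (real ^ 'n). flat_exp 0 (1 + (- 1) * (z \<bullet> (1 / 2 ^ j, 0)) ^ 2))"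
    by (intro smooth_term.intros smooth_term_power)
  moreover have "(\<lambda>z :: real \<times> (real ^ 'n). flat_exp 0 (1 + (- 1) * (z \<bullet> (1 / 2 ^ j, 0)) ^ 2)) =
      (\<lambda>z. bump (fst z / 2 ^ j))"
    by (auto simp: bump_def fun_eq_iff)
  moreover have "smooth_term (\<lambda>z :: real \<times> (real ^ 'n).
      inverse (sqrt ((2 ^ j)\<^sup>2 + (\<Sum>b\<in>Basis. (z \<bullet> (0, b)) ^ 2))))"
    by (intro smooth_term.intros smooth_term_power smooth_term_sum) (auto intro!: add_pos_nonneg sum_nonneg)
  moreover have "(\<lambda>z :: real \<times> (real ^ 'n). inverse (sqrt ((2 ^ j)\<^sup>2 + (\<Sum>b\<in>Basis. (z \<bullet> (0, b)) ^ 2)))) =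
      (\<lambda>z. inv_dist (2 ^ j) (snd z))"
  proof
    fix z :: "real \<times> (real ^ 'n)"
    have "(\<Sum>b\<in>Basis. (snd z \<bullet> b) ^ 2) = (norm (snd z))\<^sup>2"
      unfolding power2_norm_eq_inner using euclidean_inner[of "snd z" "snd z"]
      by (simp add: power2_eq_square)
    then show "inverse (sqrt ((2 ^ j)\<^sup>2 + (\<Sum>b\<in>Basis. (z \<bullet> (0, b)) ^ 2))) = inv_dist (2 ^ j) (snd z)"
      by (cases z) (simp add: inv_dist_def)
  qed
  ultimately show ?thesis
    unfolding layer_def by (intro smooth_term.mult smooth_term_cmult) simp_all
qed

lemma C_infinity_log_profile: "C_infinity (\<lambda>z. complex_of_real (log_profile J z))"
  unfolding log_profile_def case_prod_unfold
  by (intro smooth_term_imp_C_infinity smooth_term_sum smooth_term_cmult smooth_term_power smooth_term_layer)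

lemma time_deriv_log_profile:
  "time_deriv (\<lambda>z. complex_of_real (log_profile J z)) = (\<lambda>z. complex_of_real (log_profile_dt J z))"
proof
  fix z :: "real \<times> (real ^ 'n)"
  obtain t x where z: "z = (t, x)" by (cases z)
  have "((\<lambda>t. bump (t / 2 ^ j)) has_real_derivative bump' (t / 2 ^ j) * (1 / 2 ^ j)) (at t)" for j
    by (rule DERIV_chain2[OF has_real_derivative_bump]) (auto intro!: derivative_eq_intros)
  then have "((\<lambda>t. bump (t / 2 ^ j) ^ Suc CARD('n)) has_real_derivative
       real (Suc CARD('n)) * bump (t / 2 ^ j) ^ CARD('n) * bump' (t / 2 ^ j) / 2 ^ j) (at t)" for j
    by (rule DERIV_cong[OF DERIV_power]) (simp add: mult_ac)
  then have "((\<lambda>t. log_profile J (t, x)) has_real_derivative log_profile_dt J (t, x)) (at t)"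
    unfolding log_profile_def log_profile_dt_def layer_def power_mult_distrib case_prod_conv mult.assoc[symmetric]
    by (intro DERIV_sum DERIV_cmult_right DERIV_cmult) (simp add: mult.assoc)
  then have "((\<lambda>t. complex_of_real (log_profile J (t, x))) has_vector_derivative
      complex_of_real (log_profile_dt J (t, x))) (at t)"
    by (intro has_vector_derivative_of_real) (simp add: has_real_derivative_iff_has_vector_derivative)
  then show "time_deriv (\<lambda>z. complex_of_real (log_profile J z)) z = complex_of_real (log_profile_dt J z)"
    by (simp add: time_deriv_def z vector_derivative_at)
qed

lemma layer_power_eq_poisson:
  fixes x :: "real ^ 'n"
  shows "layer j t x ^ Suc CARD('n) =
    bump (t / 2 ^ j) ^ Suc CARD('n) * ((2 ^ j) ^ CARD('n) * poisson (2 ^ j) x)"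
  by (simp add: layer_def poisson_def power_mult_distrib mult_ac)

text \<open>On each time slice the test function is a finite combination of Poisson kernels at the heights
  \<open>2\<^sup>j\<close>.\<close>
lemma is_half_laplacian_log_profile:
  "is_half_laplacian_x (\<lambda>z :: real \<times> (real ^ 'n). complex_of_real (log_profile J z)) (\<lambda>z. complex_of_real (log_profile_half_lap J z))"
  unfolding is_half_laplacian_x_def
proof (intro AE_I2)
  fix t
  define c where "c j = weight CARD('n) J j * bump (t / 2 ^ j) ^ Suc CARD('n) * (2 ^ j) ^ CARD('n)" for j
  define P where "P j x = complex_of_real (poisson (2 ^ j) (x :: real ^ 'n))" for j x
  define Q where "Q j x = - complex_of_real (poisson_ds (2 ^ j) (x :: real ^ 'n))" for j x
  have phi: "(\<lambda>x :: real ^ 'n. complex_of_real (log_profile J (t, x))) = (\<lambda>x. \<Sum>j\<le>J. of_real (c j) * P j x)"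
    unfolding log_profile_def case_prod_conv layer_power_eq_poisson
    by (simp add: c_def P_def mult_ac fun_eq_iff)
  have g: "(\<lambda>x :: real ^ 'n. complex_of_real (log_profile_half_lap J (t, x))) = (\<lambda>x. \<Sum>j\<le>J. of_real (c j) * Q j x)"
    unfolding log_profile_half_lap_def
    by (simp add: c_def Q_def mult_ac fun_eq_iff sum_negf)
  have int: "integrable lborel (P j)" "integrable lborel (Q j)" for j
    unfolding P_def Q_def
    by (intro integrable_of_real Bochner_Integration.integrable_minus integrable_poisson; simp)+
  then have int': "integrable lborel (\<lambda>x. of_real (c j) * P j x)" "integrable lborel (\<lambda>x. of_real (c j) * Q j x)" for j
    by (intro integrable_mult_right; simp)+
  have cmult: "fourier (\<lambda>x. of_real r * h x) \<xi> = of_real r * fourier h \<xi>" for r :: real and h and \<xi> :: "real ^ 'n"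
    by (simp add: fourier_def mult.left_commute[of _ "of_real r"])
  have PQ: "fourier (Q j) \<xi> = of_real (norm \<xi>) * fourier (P j) \<xi>" for j \<xi>
    unfolding P_def Q_def by (rule fourier_poisson_ds) simp
  show "is_half_laplacian (\<lambda>x :: real ^ 'n. complex_of_real (log_profile J (t, x)))
      (\<lambda>x. complex_of_real (log_profile_half_lap J (t, x)))"
    unfolding is_half_laplacian_def phi g
  proof (intro conjI allI)
    fix \<xi> :: "real ^ 'n"
    show "fourier (\<lambda>x. \<Sum>j\<le>J. of_real (c j) * Q j x) \<xi> =
        of_real (norm \<xi>) * fourier (\<lambda>x. \<Sum>j\<le>J. of_real (c j) * P j x) \<xi>"
      by (simp add: fourier_sum int' cmult PQ sum_distrib_left mult.left_commute)
  qed (intro Bochner_Integration.integrable_sum int')+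
qed

lemma bump_measurable [measurable]: "bump \<in> borel_measurable borel" "bump' \<in> borel_measurable borel"
proof -
  have [measurable]: "flat_exp k \<in> borel_measurable borel" for k
    unfolding flat_exp_def by measurable
  show "bump \<in> borel_measurable borel" "bump' \<in> borel_measurable borel"
    unfolding bump_def bump'_def by measurable
qed

lemma bump_scaled_eq_0:
  assumes "\<bar>t\<bar> > 2 ^ j" shows "bump (t / 2 ^ j) = 0"
proof -
  have "\<bar>t / 2 ^ j\<bar> \<ge> 1" using assms by (simp add: field_simps)
  then show ?thesis by (rule bump_eq_0)
qed

lemma L1_Linf_log_profile:
  "L1_Linf (\<lambda>z :: real \<times> (real ^ 'n). complex_of_real (log_profile J z))"
  "L1_Linf (\<lambda>z :: real \<times> (real ^ 'n). complex_of_real (log_profile_dt J z))"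
  "L1_Linf (\<lambda>z :: real \<times> (real ^ 'n). complex_of_real (log_profile_half_lap J z))"
proof -
  have le1: "(2 ^ j * inv_dist (2 ^ j) x) ^ Suc CARD('n) \<le> 1" for j and x :: "real ^ 'n"
    by (intro power_le_one inv_dist_mult_le mult_nonneg_nonneg inv_dist_nonneg) auto
  have int1: "integrable lborel (\<lambda>x :: real ^ 'n. (2 ^ j * inv_dist (2 ^ j) x) ^ Suc CARD('n))" for j
    unfolding power_mult_distrib using integrable_inv_dist_power[of "2 ^ j", where 'a="real ^ 'n"]
    by (intro integrable_mult_right) simp
  have bump_pow: "bump s ^ k \<le> 1" "0 \<le> bump s ^ k" for s k
    by (simp_all add: power_le_one bump_nonneg bump_le_1)
  have term1: "L1_Linf (\<lambda>(t, x). complex_of_real ((weight CARD('n) J j * bump (t / 2 ^ j) ^ Suc CARD('n)) *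
      (2 ^ j * inv_dist (2 ^ j) (x :: real ^ 'n)) ^ Suc CARD('n)))" for j
  proof (rule L1_Linf_separable[where a="weight CARD('n) J j" and R="2 ^ j", OF _ _ _ int1])
    show "\<bar>weight CARD('n) J j * bump (t / 2 ^ j) ^ Suc CARD('n)\<bar> \<le> weight CARD('n) J j" for t
      unfolding abs_mult abs_of_nonneg[OF weight_nonneg] abs_of_nonneg[OF bump_pow(2)]
      by (rule mult_left_le[OF bump_pow(1) weight_nonneg])
    show "\<bar>(2 ^ j * inv_dist (2 ^ j) x) ^ Suc CARD('n)\<bar> \<le> 1" for x :: "real ^ 'n"
      using le1[of j x] by (subst abs_of_nonneg) (auto intro!: zero_le_power mult_nonneg_nonneg inv_dist_nonneg simp del: power_Suc)
  qed (use bump_scaled_eq_0 in auto)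
  have term2: "L1_Linf (\<lambda>(t, x). complex_of_real ((weight CARD('n) J j *
      (real (Suc CARD('n)) * bump (t / 2 ^ j) ^ CARD('n) * bump' (t / 2 ^ j) / 2 ^ j)) *
      (2 ^ j * inv_dist (2 ^ j) (x :: real ^ 'n)) ^ Suc CARD('n)))" for j
  proof (rule L1_Linf_separable[where a="weight CARD('n) J j * (real (Suc CARD('n)) * 1 * 4 / 2 ^ j)" and R="2 ^ j", OF _ _ _ int1])
    show "\<bar>weight CARD('n) J j * (real (Suc CARD('n)) * bump (t / 2 ^ j) ^ CARD('n) * bump' (t / 2 ^ j) / 2 ^ j)\<bar>
        \<le> weight CARD('n) J j * (real (Suc CARD('n)) * 1 * 4 / 2 ^ j)" for t
    proof -
      have "\<bar>bump (t / 2 ^ j) ^ CARD('n) * bump' (t / 2 ^ j)\<bar> \<le> 1 * 4"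
        unfolding abs_mult abs_of_nonneg[OF bump_pow(2)]
        by (rule mult_mono[OF bump_pow(1) abs_bump'_le]) auto
      then have "\<bar>real (Suc CARD('n)) * bump (t / 2 ^ j) ^ CARD('n) * bump' (t / 2 ^ j) / 2 ^ j\<bar>
          \<le> real (Suc CARD('n)) * 1 * 4 / 2 ^ j"
        by (simp add: abs_mult mult.assoc divide_right_mono del: of_nat_Suc)
      then show ?thesis
        unfolding abs_mult[of "weight _ _ _"] abs_of_nonneg[OF weight_nonneg]
        by (rule mult_left_mono[OF _ weight_nonneg])
    qed
    show "\<bar>(2 ^ j * inv_dist (2 ^ j) x) ^ Suc CARD('n)\<bar> \<le> 1" for x :: "real ^ 'n"
      using le1[of j x] by (subst abs_of_nonneg) (auto intro!: zero_le_power mult_nonneg_nonneg inv_dist_nonneg simp del: power_Suc)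
  qed (use bump_scaled_eq_0 in \<open>auto simp: zero_power\<close>)
  have term3: "L1_Linf (\<lambda>(t, x). complex_of_real ((weight CARD('n) J j * bump (t / 2 ^ j) ^ Suc CARD('n)) *
      ((2 ^ j) ^ CARD('n) * - poisson_ds (2 ^ j) (x :: real ^ 'n))))" for j
  proof (rule L1_Linf_separable[where a="weight CARD('n) J j" and R="2 ^ j"])
    show "\<bar>weight CARD('n) J j * bump (t / 2 ^ j) ^ Suc CARD('n)\<bar> \<le> weight CARD('n) J j" for t
      unfolding abs_mult abs_of_nonneg[OF weight_nonneg] abs_of_nonneg[OF bump_pow(2)]
      by (rule mult_left_le[OF bump_pow(1) weight_nonneg])
    show "integrable lborel (\<lambda>x :: real ^ 'n. (2 ^ j) ^ CARD('n) * - poisson_ds (2 ^ j) x)"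
      by (intro integrable_mult_right Bochner_Integration.integrable_minus integrable_poisson) simp
    obtain b :: "real ^ 'n" where b: "norm b = 1" using vector_choose_size[of 1] by auto
    show "\<bar>(2 ^ j) ^ CARD('n) * - poisson_ds (2 ^ j) x\<bar> \<le>
        (2 ^ j) ^ CARD('n) * ((real DIM(real^'n) + 1) * (real DIM(real^'n) + 6) * (1 / 2 ^ j) ^ (DIM(real^'n) + 1))"
      for x :: "real ^ 'n"
    proof -
      have "inv_dist (2 ^ j) x \<le> 1 / 2 ^ j"
        using inv_dist_mult_le[of "2 ^ j" x] by (simp add: field_simps)
      then have "inv_dist (2 ^ j) x ^ (DIM(real^'n) + 1) \<le> (1 / 2 ^ j) ^ (DIM(real^'n) + 1)"
        by (intro power_mono inv_dist_nonneg)
      then have "(real DIM(real^'n) + 1) * (real DIM(real^'n) + 6) * inv_dist (2 ^ j) x ^ (DIM(real^'n) + 1)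
          \<le> (real DIM(real^'n) + 1) * (real DIM(real^'n) + 6) * (1 / 2 ^ j) ^ (DIM(real^'n) + 1)"
        by (rule mult_left_mono) simp
      with poisson_bounds(2)[OF _ b, of "2 ^ j" x]
      have "\<bar>poisson_ds (2 ^ j) x\<bar> \<le>
          (real DIM(real^'n) + 1) * (real DIM(real^'n) + 6) * (1 / 2 ^ j) ^ (DIM(real^'n) + 1)"
        by (meson order_trans zero_less_numeral zero_less_power)
      from mult_left_mono[OF this, of "(2 ^ j) ^ CARD('n)"] show ?thesis
        by (simp only: abs_mult abs_minus_cancel power_abs abs_numeral) simp
    qed
  qed (use bump_scaled_eq_0 in auto)
  show "L1_Linf (\<lambda>z :: real \<times> (real ^ 'n). complex_of_real (log_profile J z))"
    using L1_Linf_sum[of "{..J}", OF _ term1]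
    by (simp add: log_profile_def layer_def case_prod_unfold power_mult_distrib mult_ac)
  show "L1_Linf (\<lambda>z :: real \<times> (real ^ 'n). complex_of_real (log_profile_dt J z))"
    using L1_Linf_sum[of "{..J}", OF _ term2]
    by (simp add: log_profile_dt_def case_prod_unfold)
  show "L1_Linf (\<lambda>z :: real \<times> (real ^ 'n). complex_of_real (log_profile_half_lap J z))"
    using L1_Linf_sum[of "{..J}", OF _ term3]
    by (simp add: log_profile_half_lap_def case_prod_unfold)
qed

lemma log_profile_eq_0:
  assumes "t \<ge> 2 ^ J"
  shows "log_profile J (t, x) = 0" "log_profile_dt J (t, x) = 0" "log_profile_half_lap J (t, x) = 0"
proof -
  have "bump (t / 2 ^ j) = 0" if "j \<le> J" for j
  proof -
    have "(2::real) ^ j \<le> 2 ^ J" using that by simp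
    then have "2 ^ j \<le> \<bar>t\<bar>" using assms by linarith
    then have "\<bar>t / 2 ^ j\<bar> \<ge> 1" by (simp add: field_simps)
    then show ?thesis by (rule bump_eq_0)
  qed
  then show "log_profile J (t, x) = 0" "log_profile_dt J (t, x) = 0" "log_profile_half_lap J (t, x) = 0"
    by (simp_all add: log_profile_def log_profile_dt_def log_profile_half_lap_def layer_def zero_power)
qed

lemma test_function_log_profile:
  assumes "2 ^ J \<le> T"
  shows "test_function T (\<lambda>z :: real \<times> (real ^ 'n). complex_of_real (log_profile J z))
     (\<lambda>z. complex_of_real (log_profile_half_lap J z))"
  unfolding test_function_def time_deriv_log_profile
proof (intro conjI C_infinity_log_profile is_half_laplacian_log_profile L1_Linf_log_profile)
  show "closure {z :: real \<times> (real ^ 'n). complex_of_real (log_profile J z) \<noteq> 0} \<subseteq> {..T} \<times> UNIV"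
  proof (rule closure_minimal)
    show "closed ({..T} \<times> (UNIV :: (real ^ 'n) set))"
      by (intro closed_Times) auto
    show "{z. complex_of_real (log_profile J z) \<noteq> 0} \<subseteq> {..T} \<times> (UNIV :: (real ^ 'n) set)"
    proof
      fix z :: "real \<times> (real ^ 'n)"
      assume "z \<in> {z. complex_of_real (log_profile J z) \<noteq> 0}"
      then have "\<not> 2 ^ J \<le> fst z"
        using log_profile_eq_0(1)[of J "fst z" "snd z"] by auto
      then show "z \<in> {..T} \<times> UNIV"
        using assms by (cases z) auto
    qed
  qed
qed

text \<open>The first factor comes from differentiating a single layer in time and from the half
  Laplacian of its Poisson kernel, the second one from the summation over the scales.\<close>
definition profile_const :: "nat \<Rightarrow> real" where
  "profile_const n = (4 * (real n + 1) + (real n + 1) * (real n + 6)) * (3 * real (Suc n) * (2 + 4 * 2 ^ n))"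

lemma profile_const_nonneg: "profile_const n \<ge> 0"
  by (simp add: profile_const_def)

lemma log_profile_nonneg: "log_profile J z \<ge> 0"
  by (auto simp: log_profile_def weight_nonneg layer_nonneg split: prod.split
      intro!: sum_nonneg mult_nonneg_nonneg zero_le_power simp del: power_Suc)

text \<open>Both the time derivative and the half Laplacian of the layer at scale \<open>2\<^sup>j\<close> cost a factor
  \<open>2\<^sup>-\<^sup>j\<close> and at most one power of the bump; as \<open>2\<^sup>-\<^sup>j (2\<^sup>j inv_dist (2\<^sup>j) x) = inv_dist (2\<^sup>j) x\<close>, what
  remains is the sum in \<open>layer_sum_estimate\<close>.\<close>
lemma log_profile_estimate:
  fixes x :: "real ^ 'n"
  assumes t: "t \<ge> 0"
  shows "\<bar>log_profile_dt J (t, x)\<bar> + \<bar>log_profile_half_lap J (t, x)\<bar> \<le>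
    profile_const CARD('n) * root (Suc CARD('n)) (log_profile J (t, x)) ^ CARD('n)
      * inverse (1 + t + norm x)"
proof -
  let ?n = "CARD('n)"
  define K where "K = (real ?n + 1) * (real ?n + 6)"
  define A where "A j = weight ?n J j * inv_dist (2 ^ j) x * layer j t x ^ ?n" for j
  define \<psi> where "\<psi> = root (Suc ?n) (log_profile J (t, x))"
  have psi: "\<psi> \<ge> 0" "\<psi> ^ Suc ?n = (\<Sum>j\<le>J. weight ?n J j * layer j t x ^ Suc ?n)"
    using log_profile_nonneg[of J "(t, x)"]
    by (auto simp: \<psi>_def log_profile_def real_root_pow_pos2 simp del: power_Suc)
  have A_nonneg: "A j \<ge> 0" for j
    by (simp add: A_def weight_nonneg inv_dist_nonneg layer_nonneg)
  have theta: "0 \<le> 2 ^ j * inv_dist (2 ^ j) x" "2 ^ j * inv_dist (2 ^ j) x \<le> 1" for j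
    using inv_dist_mult_le[of "2 ^ j" x] by (auto simp: inv_dist_nonneg)
  have "\<bar>log_profile_dt J (t, x)\<bar> \<le> (\<Sum>j\<le>J. 4 * (real ?n + 1) * A j)"
    unfolding log_profile_dt_def case_prod_conv
  proof (rule order_trans[OF sum_abs sum_mono])
    fix j
    let ?th = "2 ^ j * inv_dist (2 ^ j) x"
    have "weight ?n J j * (real (Suc ?n) * bump (t / 2 ^ j) ^ ?n * bump' (t / 2 ^ j) / 2 ^ j) * ?th ^ Suc ?n =
       (real ?n + 1) * A j * bump' (t / 2 ^ j)"
      by (simp add: A_def layer_def power_mult_distrib field_simps)
    also have "\<bar>\<dots>\<bar> \<le> (real ?n + 1) * A j * 4"
      unfolding abs_mult using abs_bump'_le[of "t / 2 ^ j"] A_nonneg[of j]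
      by (intro mult_mono) auto
    finally show "\<bar>weight ?n J j * (real (Suc ?n) * bump (t / 2 ^ j) ^ ?n * bump' (t / 2 ^ j) / 2 ^ j) * ?th ^ Suc ?n\<bar>
        \<le> 4 * (real ?n + 1) * A j" by (simp only: mult_ac)
  qed
  moreover have "\<bar>log_profile_half_lap J (t, x)\<bar> \<le> (\<Sum>j\<le>J. K * A j)"
    unfolding log_profile_half_lap_def case_prod_conv
  proof (rule order_trans[OF sum_abs sum_mono])
    fix j
    define k where "k = inv_dist (2 ^ j) x"
    define B where "B = bump (t / 2 ^ j)"
    have B: "0 \<le> B" "B \<le> 1" by (auto simp: B_def bump_nonneg bump_le_1)
    have W: "0 \<le> weight ?n J j * B ^ ?n * (2 ^ j) ^ ?n"
      using B weight_nonneg[of ?n J j] by simp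
    obtain b :: "real ^ 'n" where b: "norm b = 1" using vector_choose_size[of 1] by auto
    have "\<bar>poisson_ds (2 ^ j) x\<bar> \<le> K * k ^ (?n + 1)"
      using poisson_bounds(2)[OF _ b, of "2 ^ j" x] by (simp add: K_def k_def)
    then have "B * \<bar>poisson_ds (2 ^ j) x\<bar> \<le> 1 * (K * k ^ (?n + 1))"
      using B by (intro mult_mono) (auto simp: K_def k_def)
    from mult_left_mono[OF this W]
    show "\<bar>weight ?n J j * bump (t / 2 ^ j) ^ Suc ?n * ((2 ^ j) ^ ?n * - poisson_ds (2 ^ j) x)\<bar> \<le> K * A j"
      using B weight_nonneg[of ?n J j]
      by (simp add: A_def layer_def abs_mult k_def[symmetric] B_def[symmetric] power_mult_distrib mult_ac)
  qed
  ultimately have "\<bar>log_profile_dt J (t, x)\<bar> + \<bar>log_profile_half_lap J (t, x)\<bar> \<le>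
      (4 * (real ?n + 1) + K) * (\<Sum>j\<le>J. A j)"
    unfolding distrib_right sum_distrib_left sum.distrib by linarith
  also have "\<dots> \<le> (4 * (real ?n + 1) + K) *
      (3 * real (Suc ?n) * (2 + 4 * 2 ^ ?n) * \<psi> ^ ?n * inverse (1 + t + norm x))"
    unfolding A_def
    by (intro mult_left_mono layer_sum_estimate t psi) (auto simp: K_def Suc_le_eq)
  finally show ?thesis
    unfolding \<psi>_def[symmetric] profile_const_def K_def by (simp only: mult_ac)
qed

lemma log_profile_initial:
  fixes x :: "real ^ 'n"
  shows "real (Suc J) ^ Suc CARD('n) * layer 0 0 x ^ Suc CARD('n) \<le> log_profile J (0, x)"
  using layer_le_weighted_sum[of "\<lambda>j. layer j 0 x" 0 J "CARD('n)"]
  by (simp add: log_profile_def layer_nonneg layer_mono power_mult_distrib del: power_Suc)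

section \<open>The weak identity and the bound on the existence time\<close>

text \<open>Young's inequality for the conjugate exponents \<open>(n + 1) / n\<close> and \<open>n + 1\<close>, without the optimal
  constants: the product is at most the first or the second summand according as \<open>a \<le> b\<^sup>n\<close> fails
  or holds.\<close>
lemma mult_le_powr_plus_power:
  fixes a b :: real
  assumes n: "n \<ge> 1" and a: "a \<ge> 0" and b: "b \<ge> 0"
  shows "a * b \<le> a powr ((real n + 1) / real n) + b ^ Suc n"
proof (cases "a \<le> b ^ n")
  case True
  then have "a * b \<le> b ^ Suc n" using mult_right_mono[OF True b] by (simp add: mult.commute)
  then show ?thesis by (simp add: add_increasing)
next
  case False
  then have a0: "a > 0" using b zero_le_power[OF b, of n] by linarith
  have "b = (b ^ n) powr (1 / real n)"
    using b n by (cases "b = 0") (auto simp: powr_powr simp flip: powr_realpow)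
  also have "\<dots> \<le> a powr (1 / real n)"
    using False b by (intro powr_mono2) auto
  finally have "a * b \<le> a powr 1 * a powr (1 / real n)"
    using a0 by simp
  also have "\<dots> = a powr ((real n + 1) / real n)"
    using n unfolding powr_add[symmetric] by (simp add: field_simps)
  finally show ?thesis
    using b by (simp add: add_increasing2)
qed

text \<open>Turns the first summand of Young's inequality for \<open>\<bar>u\<bar> \<psi>\<^sup>n\<close>, where \<open>\<psi>\<^sup>n\<^sup>+\<^sup>1 = \<phi>\<close>, into the
  nonlinear term \<open>\<bar>u\<bar>\<^sup>p \<phi>\<close> of the weak identity.\<close>
lemma powr_mult_root_power:
  fixes a \<phi> :: real
  assumes n: "n \<ge> 1" and a: "a \<ge> 0" and \<phi>: "\<phi> \<ge> 0"
  shows "(a * root (Suc n) \<phi> ^ n) powr ((real n + 1) / real n) = a powr ((real n + 1) / real n) * \<phi>"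
proof -
  have "(root (Suc n) \<phi> ^ n) powr ((real n + 1) / real n) = \<phi>"
  proof (cases "\<phi> = 0")
    case True
    then show ?thesis using n by (simp add: zero_power)
  next
    case False
    then have "root (Suc n) \<phi> > 0" using \<phi> by simp
    then have "(root (Suc n) \<phi> ^ n) powr ((real n + 1) / real n) = root (Suc n) \<phi> powr (real (Suc n))"
      using n by (simp add: powr_powr add.commute flip: powr_realpow)
    also have "\<dots> = \<phi>"
      using \<open>root (Suc n) \<phi> > 0\<close> \<phi> by (simp only: powr_realpow) (simp add: real_root_pow_pos2 del: power_Suc)
    finally show ?thesis .
  qed
  then show ?thesis
    using a \<phi> by (simp add: powr_mult)
qed

text \<open>The substitution \<open>x = (1 + t) y\<close>. The remaining factor \<open>1 / (1 + t)\<close> makes the integral over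
  time logarithmic, which is where the critical exponent enters.\<close>
lemma decay_integral:
  fixes t :: real
  assumes t: "t \<ge> 0"
  shows "integrable lborel (\<lambda>x::'a::euclidean_space. inverse (1 + t + norm x) ^ Suc DIM('a))"
    and "(LINT x|lborel. inverse (1 + t + norm (x::'a)) ^ Suc DIM('a)) =
      inverse (1 + t) * (LINT x|lborel. inverse (1 + norm (x::'a)) ^ Suc DIM('a))"
proof -
  define s where "s = 1 + t"
  have s: "s > 0" using t by (simp add: s_def)
  let ?h = "\<lambda>x::'a. inverse (1 + norm x) ^ Suc DIM('a)"
  have h: "integrable lborel ?h"
    using integrable_inverse_one_plus_norm[where 'a='a] by simp
  have eq: "inverse (1 + t + norm x) ^ Suc DIM('a) = inverse s ^ Suc DIM('a) * ?h (inverse s *\<^sub>R x)" for x :: 'a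
  proof -
    have "inverse (1 + t + norm x) = inverse s * inverse (1 + norm (inverse s *\<^sub>R x))"
      using s unfolding s_def[symmetric] by (simp add: field_simps)
    then show ?thesis by (simp only: power_mult_distrib)
  qed
  note sc = lborel_scaling[OF h, of "inverse s"]
  show "integrable lborel (\<lambda>x::'a. inverse (1 + t + norm x) ^ Suc DIM('a))"
    unfolding eq using sc(1) s by (intro integrable_mult_right) simp
  show "(LINT x|lborel. inverse (1 + t + norm (x::'a)) ^ Suc DIM('a)) =
      inverse (1 + t) * (LINT x|lborel. inverse (1 + norm (x::'a)) ^ Suc DIM('a))"
    unfolding eq integral_mult_right_zero using s
    by (subst sc(2)) (simp_all add: s_def power_inverse)
qed

lemma integral_inverse_one_plus:
  assumes b: "b \<ge> 0"
  shows "integrable lborel (\<lambda>t. indicator {0..b} t * inverse (1 + t) :: real)"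
    and "(LINT t|lborel. indicator {0..b} t * inverse (1 + t)) = ln (1 + b)"
proof -
  have "has_bochner_integral lborel (\<lambda>t. inverse (1 + t) * indicator {0..b} t) (ln (1 + b) - ln (1 + 0))"
    by (rule has_bochner_integral_FTC_Icc_nonneg)
       (use b in \<open>auto intro!: derivative_eq_intros simp: divide_inverse\<close>)
  then show "integrable lborel (\<lambda>t. indicator {0..b} t * inverse (1 + t) :: real)"
    "(LINT t|lborel. indicator {0..b} t * inverse (1 + t)) = ln (1 + b)"
    by (auto simp: has_bochner_integral_iff mult.commute)
qed

definition decay_mass :: "'a::euclidean_space itself \<Rightarrow> real" where
  "decay_mass _ = (LINT x|lborel. inverse (1 + norm (x::'a)) ^ Suc DIM('a))"

text \<open>The estimate of the left-hand side of the weak identity on a single time slice. The first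
  summand on the right is exactly the nonlinear term, so that it cancels after integration in time.\<close>
lemma log_profile_spatial_bound:
  fixes u :: "real \<times> (real ^ 'n) \<Rightarrow> complex"
  defines "p \<equiv> (real CARD('n) + 1) / real CARD('n)"
  assumes t: "t > 0"
    and u: "integrable lborel (\<lambda>x. norm (u (t, x)) powr p)"
  shows "norm (LINT x|lborel. u (t, x) *
      cnj (\<i> * of_real (log_profile_dt J (t, x)) + of_real (log_profile_half_lap J (t, x))))
    \<le> (LINT x|lborel. norm (u (t, x)) powr p * log_profile J (t, x))
      + profile_const CARD('n) ^ Suc CARD('n) * decay_mass TYPE(real ^ 'n) * (indicator {0..2 ^ J} t * inverse (1 + t))"
    (is "norm (LINT x|lborel. ?F x) \<le> ?\<alpha> + ?\<beta>")
proof (cases "t \<ge> 2 ^ J")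
  case True
  have "?\<alpha> \<ge> 0"
    by (intro integral_nonneg_AE) (simp add: log_profile_nonneg)
  moreover have "?\<beta> \<ge> 0"
    using t by (auto simp: decay_mass_def profile_const_nonneg indicator_def intro!: mult_nonneg_nonneg integral_nonneg_AE zero_le_power simp del: power_Suc)
  ultimately show ?thesis by (simp add: log_profile_eq_0[OF True])
next
  case False
  let ?n = "CARD('n)"
  define C where "C = profile_const ?n"
  have n: "?n \<ge> 1" by (simp add: Suc_le_eq)
  have C: "C \<ge> 0" by (simp add: C_def profile_const_nonneg)
  have bounded: "norm (log_profile J (t, x)) \<le> (\<Sum>j\<le>J. weight ?n J j)" for x :: "real ^ 'n"
  proof -
    show ?thesis
      unfolding log_profile_def case_prod_conv
      by (intro order_trans[OF norm_sum] sum_mono)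
         (auto simp: abs_mult weight_nonneg layer_nonneg layer_le_1 abs_of_nonneg simp del: power_Suc
            intro!: mult_left_le power_le_one)
  qed
  have meas: "(\<lambda>x. log_profile J (t, x)) \<in> borel_measurable lborel"
    unfolding log_profile_def by simp
  have int_a: "integrable lborel (\<lambda>x. norm (u (t, x)) powr p * log_profile J (t, x))"
  proof (rule Bochner_Integration.integrable_bound[OF integrable_mult_right[OF u, of "\<Sum>j\<le>J. weight ?n J j"]])
    show "(\<lambda>x. norm (u (t, x)) powr p * log_profile J (t, x)) \<in> borel_measurable lborel"
      using borel_measurable_integrable[OF u] meas by (rule borel_measurable_times)
    show "AE x in lborel. norm (norm (u (t, x)) powr p * log_profile J (t, x))
        \<le> norm ((\<Sum>j\<le>J. weight ?n J j) * norm (u (t, x)) powr p)"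
      using bounded by (intro AE_I2) (simp add: abs_mult sum_nonneg weight_nonneg mult.commute mult_right_mono)
  qed
  have int_b: "integrable lborel (\<lambda>x::real ^ 'n. (C * inverse (1 + t + norm x)) ^ Suc ?n)"
    unfolding power_mult_distrib using decay_integral(1)[of t, where 'a="real ^ 'n"] t
    by (intro integrable_mult_right) simp
  have pointwise: "norm (?F x) \<le> norm (u (t, x)) powr p * log_profile J (t, x)
      + (C * inverse (1 + t + norm x)) ^ Suc ?n" for x
  proof -
    define \<psi> where "\<psi> = root (Suc ?n) (log_profile J (t, x))"
    have psi: "\<psi> \<ge> 0" by (simp add: \<psi>_def log_profile_nonneg)
    have "norm (?F x) \<le> norm (u (t, x)) * (\<bar>log_profile_dt J (t, x)\<bar> + \<bar>log_profile_half_lap J (t, x)\<bar>)"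
      unfolding norm_mult complex_mod_cnj
      by (intro mult_left_mono order_trans[OF norm_triangle_ineq]) (auto simp: norm_mult)
    also have "\<dots> \<le> norm (u (t, x)) * (C * \<psi> ^ ?n * inverse (1 + t + norm x))"
      unfolding C_def \<psi>_def using t by (intro mult_left_mono log_profile_estimate) auto
    also have "\<dots> = (norm (u (t, x)) * \<psi> ^ ?n) * (C * inverse (1 + t + norm x))"
      by (simp only: mult_ac)
    also have "\<dots> \<le> (norm (u (t, x)) * \<psi> ^ ?n) powr p + (C * inverse (1 + t + norm x)) ^ Suc ?n"
      unfolding p_def using n psi C t by (intro mult_le_powr_plus_power) auto
    also have "(norm (u (t, x)) * \<psi> ^ ?n) powr p = norm (u (t, x)) powr p * log_profile J (t, x)"
      unfolding p_def \<psi>_def by (intro powr_mult_root_power n log_profile_nonneg) simp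
    finally show ?thesis .
  qed
  have "norm (LINT x|lborel. ?F x) \<le> (LINT x|lborel. norm (?F x))"
    by (rule integral_norm_bound)
  also have "\<dots> \<le> (LINT x|lborel. norm (u (t, x)) powr p * log_profile J (t, x)
      + (C * inverse (1 + t + norm x)) ^ Suc ?n)"
    using pointwise C t
    by (intro integral_mono_AE' Bochner_Integration.integrable_add int_a int_b AE_I2)
       (auto simp: log_profile_nonneg intro!: add_nonneg_nonneg mult_nonneg_nonneg simp del: power_Suc)
  also have "\<dots> = ?\<alpha> + (LINT x|lborel. (C * inverse (1 + t + norm (x :: real ^ 'n))) ^ Suc ?n)"
    by (rule Bochner_Integration.integral_add[OF int_a int_b])
  also have "(LINT x|lborel. (C * inverse (1 + t + norm (x :: real ^ 'n))) ^ Suc ?n) = ?\<beta>"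
    unfolding power_mult_distrib integral_mult_right_zero
    using decay_integral(2)[of t, where 'a="real ^ 'n"] t False
    by (simp add: C_def decay_mass_def)
  finally show ?thesis by simp
qed

lemma log_profile_initial_mass:
  fixes f :: "real ^ 'n \<Rightarrow> real"
  assumes f: "integrable lebesgue f" and pos: "\<And>x. f x > 0"
  shows "(LINT x|lebesgue. f x * layer 0 0 x ^ Suc CARD('n)) > 0"
    and "real (Suc J) ^ Suc CARD('n) * (LINT x|lebesgue. f x * layer 0 0 x ^ Suc CARD('n))
      \<le> (LINT x|lebesgue. f x * log_profile J (0, x))"
proof -
  let ?n = "CARD('n)"
  have meas [measurable]: "layer j 0 \<in> borel_measurable (lebesgue :: (real ^ 'n) measure)" for j
    by (intro measurable_completion) simp
  have f_meas [measurable]: "f \<in> borel_measurable lebesgue"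
    using f by simp
  have int: "integrable lebesgue (\<lambda>x. f x * layer j 0 x ^ Suc ?n)" for j
  proof (rule Bochner_Integration.integrable_bound[OF f])
    show "AE x in lebesgue. norm (f x * layer j 0 x ^ Suc ?n) \<le> norm (f x)"
      by (intro AE_I2) (auto simp: abs_mult layer_nonneg layer_le_1 simp del: power_Suc
          intro!: mult_left_le power_le_one)
  qed measurable
  have layer_pos: "layer 0 0 x > 0" for x :: "real ^ 'n"
    by (simp add: layer_def inv_dist_pos bump_def flat_exp_def)
  show "(LINT x|lebesgue. f x * layer 0 0 x ^ Suc ?n) > 0"
  proof -
    have nonneg: "f x * layer 0 0 x ^ Suc ?n \<ge> 0" for x
      using pos[of x] layer_pos[of x] by simp
    have "(LINT x|lebesgue. f x * layer 0 0 x ^ Suc ?n) \<noteq> 0"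
    proof
      assume "(LINT x|lebesgue. f x * layer 0 0 x ^ Suc ?n) = 0"
      then have "AE x in lebesgue. f x * layer 0 0 x ^ Suc ?n = 0"
        using integral_nonneg_eq_0_iff_AE[OF int[of 0]] nonneg by simp
      then have "AE x in (lebesgue :: (real ^ 'n) measure). False"
        by eventually_elim (use pos layer_pos in \<open>auto simp: less_imp_neq[symmetric]\<close>)
      then have "emeasure (lebesgue :: (real ^ 'n) measure) UNIV = 0"
        by (subst (asm) AE_iff_measurable[OF _ refl]) auto
      then show False
        by simp
    qed
    moreover have "(LINT x|lebesgue. f x * layer 0 0 x ^ Suc ?n) \<ge> 0"
      using nonneg by (intro integral_nonneg_AE) simp
    ultimately show ?thesis by linarith
  qed
  have eq: "f x * log_profile J (0, x) = (\<Sum>j\<le>J. weight ?n J j * (f x * layer j 0 x ^ Suc ?n))" for x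
    by (simp add: log_profile_def sum_distrib_left mult.left_commute del: power_Suc)
  have int_phi: "integrable lebesgue (\<lambda>x. f x * log_profile J (0, x))"
    unfolding eq by (intro Bochner_Integration.integrable_sum integrable_mult_right int)
  have "real (Suc J) ^ Suc ?n * (LINT x|lebesgue. f x * layer 0 0 x ^ Suc ?n) =
      (LINT x|lebesgue. real (Suc J) ^ Suc ?n * (f x * layer 0 0 x ^ Suc ?n))"
    by (rule integral_mult_right_zero[symmetric])
  also have "\<dots> \<le> (LINT x|lebesgue. f x * log_profile J (0, x))"
  proof (rule integral_mono[OF integrable_mult_right[OF int] int_phi])
    fix x
    show "real (Suc J) ^ Suc ?n * (f x * layer 0 0 x ^ Suc ?n) \<le> f x * log_profile J (0, x)"
      using mult_left_mono[OF log_profile_initial[of J x], of "f x"] pos[of x]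
      by (simp only: mult_ac less_imp_le)
  qed
  finally show "real (Suc J) ^ Suc ?n * (LINT x|lebesgue. f x * layer 0 0 x ^ Suc ?n)
      \<le> (LINT x|lebesgue. f x * log_profile J (0, x))" .
qed

text \<open>Since \<open>i f = - Im f\<close> as \<open>f\<close> is purely imaginary, the datum contributes a positive real number
  to the weak identity. It is bounded below by \<open>\<epsilon> (J + 1)\<^sup>n\<^sup>+\<^sup>1 h\<close> (\<open>log_profile_initial_mass\<close>). Once
  the nonlinear terms have cancelled, what is left of \<open>log_profile_spatial_bound\<close> integrates to
  \<open>D ln (1 + 2\<^sup>J) \<le> D (J + 1)\<close>.\<close>
lemma weak_solution_log_bound:
  fixes f :: "real ^ 'n \<Rightarrow> complex" and \<epsilon> :: real
  defines "p \<equiv> (real CARD('n) + 1) / real CARD('n)"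
  defines "h \<equiv> (LINT x|lebesgue. - Im (f x) * layer 0 0 x ^ Suc CARD('n))"
  defines "D \<equiv> profile_const CARD('n) ^ Suc CARD('n) * decay_mass TYPE(real ^ 'n)"
  assumes f: "integrable lebesgue f" "\<And>x. Re (f x) = 0" "\<And>x. - Im (f x) > 0"
    and \<epsilon>: "\<epsilon> > 0"
    and u: "weak_solution p T (\<lambda>x. of_real \<epsilon> * f x) u" and J: "2 ^ J \<le> T"
  shows "\<epsilon> * real (Suc J) ^ CARD('n) * h \<le> D"
proof -
  define \<phi> where "\<phi> = (\<lambda>z :: real \<times> (real ^ 'n). complex_of_real (log_profile J z))"
  define g where "g = (\<lambda>z :: real \<times> (real ^ 'n). complex_of_real (log_profile_half_lap J z))"
  define \<alpha> where "\<alpha> t = (LINT x|lborel. norm (u (t, x)) powr p * log_profile J (t, x))" for t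
  define F where "F t = (LINT x|lborel. u (t, x) * cnj (\<i> * time_deriv \<phi> (t, x) + g (t, x)))" for t
  define \<beta> where "\<beta> t = D * (indicator {0..2 ^ J} t * inverse (1 + t))" for t :: real
  define E where "E = (LINT x|lebesgue. - Im (f x) * log_profile J (0, x))"
  have "test_function T \<phi> g"
    unfolding \<phi>_def g_def by (rule test_function_log_profile[OF J])
  with u have F_int: "set_integrable lborel {0<..<T} F"
    and a_int: "set_integrable lborel {0<..<T}
          (\<lambda>t. LINT x|lborel. of_real (norm (u (t, x)) powr p) * cnj (\<phi> (t, x)))"
    and ident: "(LINT t:{0<..<T}|lborel. F t) = \<i> * (LINT x|lebesgue. of_real \<epsilon> * f x * cnj (\<phi> (0, x)))
          + (LINT t:{0<..<T}|lborel. LINT x|lborel. of_real (norm (u (t, x)) powr p) * cnj (\<phi> (t, x)))"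
    unfolding weak_solution_def F_def by blast+
  have \<alpha>: "(LINT x|lborel. of_real (norm (u (t, x)) powr p) * cnj (\<phi> (t, x))) = complex_of_real (\<alpha> t)" for t
    unfolding \<phi>_def \<alpha>_def complex_cnj_complex_of_real of_real_mult[symmetric] by (rule integral_complex_of_real)
  have \<alpha>_int: "set_integrable lborel {0<..<T} \<alpha>"
    using integrable_Re[OF a_int[unfolded set_integrable_def]]
    unfolding \<alpha> set_integrable_def by (simp add: scaleR_conv_of_real)
  have data: "\<i> * (LINT x|lebesgue. of_real \<epsilon> * f x * cnj (\<phi> (0, x))) = complex_of_real (\<epsilon> * E)"
  proof -
    have "\<i> * (of_real \<epsilon> * f x * cnj (\<phi> (0, x))) = complex_of_real (\<epsilon> * (- Im (f x) * log_profile J (0, x)))" for x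
      using f(2)[of x] by (simp add: \<phi>_def complex_eq_iff)
    then have "\<i> * (LINT x|lebesgue. of_real \<epsilon> * f x * cnj (\<phi> (0, x))) =
        (LINT x|lebesgue. complex_of_real (\<epsilon> * (- Im (f x) * log_profile J (0, x))))"
      by (simp only: integral_mult_right_zero[symmetric])
    also have "\<dots> = complex_of_real (\<epsilon> * E)"
      unfolding E_def integral_mult_right_zero[symmetric] by (rule integral_complex_of_real)
    finally show ?thesis .
  qed
  have u_int: "AE t in lborel. t \<in> {0<..<T} \<longrightarrow> integrable lborel (\<lambda>x. norm (u (t, x)) powr p)"
    using u by (simp add: weak_solution_def L1loc_Lq_def)
  have F_le: "AE t in lborel. t \<in> {0<..<T} \<longrightarrow> norm (F t) \<le> \<alpha> t + \<beta> t"
    using u_int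
  proof eventually_elim
    case (elim t)
    show ?case
    proof
      assume t: "t \<in> {0<..<T}"
      show "norm (F t) \<le> \<alpha> t + \<beta> t"
        unfolding F_def \<alpha>_def \<beta>_def D_def \<phi>_def g_def time_deriv_log_profile p_def
        by (rule log_profile_spatial_bound) (use t elim in \<open>auto simp: p_def\<close>)
    qed
  qed
  have D: "D \<ge> 0"
    unfolding D_def decay_mass_def
    by (intro mult_nonneg_nonneg zero_le_power profile_const_nonneg integral_nonneg_AE) simp
  have \<beta>_int: "integrable lborel \<beta>"
    unfolding \<beta>_def by (intro integrable_mult_right integral_inverse_one_plus) simp
  have \<beta>_nonneg: "\<beta> t \<ge> 0" for t
    using D by (simp add: \<beta>_def indicator_def)
  have "complex_of_real (\<epsilon> * E + (LINT t:{0<..<T}|lborel. \<alpha> t)) = (LINT t:{0<..<T}|lborel. F t)"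
    unfolding ident data \<alpha> by (simp add: set_integral_complex_of_real)
  then have "\<epsilon> * E + (LINT t:{0<..<T}|lborel. \<alpha> t) \<le> norm (LINT t:{0<..<T}|lborel. F t)"
    by (metis abs_ge_self norm_of_real)
  also have "\<dots> \<le> (LINT t:{0<..<T}|lborel. norm (F t))"
    by (rule set_integral_norm_bound[OF F_int])
  also have "\<dots> \<le> (LINT t:{0<..<T}|lborel. \<alpha> t) + (LINT t|lborel. \<beta> t)"
  proof -
    have "(LINT t:{0<..<T}|lborel. norm (F t)) \<le> (LINT t|lborel. indicator {0<..<T} t *\<^sub>R \<alpha> t + \<beta> t)"
      unfolding set_lebesgue_integral_def
    proof (rule integral_mono_AE)
      show "integrable lborel (\<lambda>t. indicator {0<..<T} t *\<^sub>R norm (F t))"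
        using set_integrable_norm[OF F_int] by (simp add: set_integrable_def)
      show "integrable lborel (\<lambda>t. indicator {0<..<T} t *\<^sub>R \<alpha> t + \<beta> t)"
        using \<alpha>_int \<beta>_int by (simp add: set_integrable_def)
      show "AE t in lborel. indicator {0<..<T} t *\<^sub>R norm (F t) \<le> indicator {0<..<T} t *\<^sub>R \<alpha> t + \<beta> t"
        using F_le by eventually_elim (auto simp: indicator_def \<beta>_nonneg)
    qed
    also have "\<dots> = (LINT t:{0<..<T}|lborel. \<alpha> t) + (LINT t|lborel. \<beta> t)"
      unfolding set_lebesgue_integral_def using \<alpha>_int \<beta>_int
      by (intro Bochner_Integration.integral_add) (simp_all add: set_integrable_def)
    finally show ?thesis .
  qed
  finally have "\<epsilon> * E \<le> (LINT t|lborel. \<beta> t)" by simp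
  also have "\<dots> = D * ln (1 + 2 ^ J)"
    unfolding \<beta>_def integral_mult_right_zero by (subst integral_inverse_one_plus) auto
  also have "\<dots> \<le> D * real (Suc J)"
  proof (rule mult_left_mono[OF _ D])
    have "ln (1 + 2 ^ J) \<le> ln ((2::real) ^ Suc J)"
      using one_le_power[of "2::real" J] by (subst ln_le_cancel_iff) (auto simp: add_pos_pos)
    also have "\<dots> = real (Suc J) * ln 2"
      by (rule ln_realpow)
    also have "\<dots> \<le> real (Suc J) * 1"
      using ln_2_less_1 by (intro mult_left_mono) auto
    finally show "ln (1 + 2 ^ J) \<le> real (Suc J)" by simp
  qed
  finally have upper: "\<epsilon> * E \<le> D * real (Suc J)" .
  have "real (Suc J) ^ Suc CARD('n) * h \<le> E"
    unfolding h_def E_def using f by (intro log_profile_initial_mass(2)) auto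
  then have "\<epsilon> * (real (Suc J) ^ Suc CARD('n) * h) \<le> \<epsilon> * E"
    using \<epsilon> by (intro mult_left_mono) auto
  with upper have "\<epsilon> * (real (Suc J) ^ Suc CARD('n) * h) \<le> D * real (Suc J)"
    by linarith
  then have "real (Suc J) * (\<epsilon> * real (Suc J) ^ CARD('n) * h) \<le> real (Suc J) * D"
    by (simp only: power_Suc mult_ac)
  then show ?thesis
    by (rule mult_left_le_imp_le) simp
qed

lemma ex_dyadic_le:
  assumes "T \<ge> (1::real)"
  obtains J where "2 ^ J \<le> T" "T < 2 ^ Suc J"
proof -
  have "\<exists>k. T < 2 ^ k" by (rule real_arch_pow) simp
  then have T: "T < 2 ^ (LEAST k. T < 2 ^ k)" by (rule LeastI_ex)
  show ?thesis
  proof (cases "LEAST k. T < 2 ^ k")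
    case 0
    then show ?thesis using T assms by simp
  next
    case (Suc J)
    then have "\<not> T < 2 ^ J"
      using not_less_Least[of J "\<lambda>k. T < 2 ^ k"] by simp
    then show ?thesis using that[of J] T Suc by simp
  qed
qed

text \<open>With \<open>J\<close> the integer part of \<open>log\<^sub>2 T\<close>, the bound \<open>\<epsilon> (J + 1)\<^sup>n h \<le> D\<close> reads
  \<open>J + 1 \<le> (D / h)\<^sup>1\<^sup>/\<^sup>n \<epsilon>\<^sup>-\<^sup>1\<^sup>/\<^sup>n\<close>, and \<open>T < 2\<^sup>J\<^sup>+\<^sup>1\<close>. The bound holds for every \<open>\<epsilon> > 0\<close>, so any \<open>\<epsilon>\<^sub>0\<close> serves.
  A global solution would have an infinite maximal existence time.\<close>
theorem theorem1p6:
  fixes f :: "real ^ 'n \<Rightarrow> complex" and p :: real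
  assumes "p = (real CARD('n) + 1) / real CARD('n)"
    and "integrable lebesgue f"
    and "\<And>x. Re (f x) = 0"
    and "\<And>x. - Im (f x) > 0"
  shows "\<exists>\<epsilon>\<^sub>0>0. \<exists>C>0. \<forall>\<epsilon>::real. 0 < \<epsilon> \<and> \<epsilon> < \<epsilon>\<^sub>0 \<longrightarrow>
           (\<nexists>u. global_weak_solution p (\<lambda>x. of_real \<epsilon> * f x) u) \<and>
           max_existence_time p (\<lambda>x. of_real \<epsilon> * f x)
             \<le> ennreal (exp (C * \<epsilon> powr (- 1 / real CARD('n))))"
proof -
  define n where "n = CARD('n)"
  define h where "h = (LINT x|lebesgue. - Im (f x) * layer 0 0 x ^ Suc CARD('n))"
  define D where "D = profile_const CARD('n) ^ Suc CARD('n) * decay_mass TYPE(real ^ 'n)"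
  define C where "C = (\<bar>D\<bar> / h) powr (1 / real n) + 1"
  have n: "n \<ge> 1" by (simp add: n_def Suc_le_eq)
  have h: "h > 0"
    unfolding h_def using assms by (intro log_profile_initial_mass(1)) auto
  have C: "C > 0" by (simp add: C_def add_nonneg_pos)
  have bound: "T \<le> exp (C * \<epsilon> powr (- 1 / real n))"
    if \<epsilon>: "0 < \<epsilon>" and u: "weak_solution p T (\<lambda>x. of_real \<epsilon> * f x) u" for \<epsilon> T u
  proof (cases "T \<ge> 1")
    case False
    then have "T \<le> exp 0" by simp
    also have "\<dots> \<le> exp (C * \<epsilon> powr (- 1 / real n))" using C by simp
    finally show ?thesis .
  next
    case True
    obtain J where J: "2 ^ J \<le> T" "T < 2 ^ Suc J" by (rule ex_dyadic_le[OF True])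
    have "\<epsilon> * real (Suc J) ^ n * h \<le> D"
      unfolding h_def D_def n_def using assms(2-) \<epsilon> u[unfolded assms(1)] J(1)
      by (rule weak_solution_log_bound)
    then have "real (Suc J) ^ n \<le> \<bar>D\<bar> / h * (1 / \<epsilon>)"
      using h \<epsilon> by (simp add: field_simps)
    then have "(real (Suc J) ^ n) powr (1 / real n) \<le> (\<bar>D\<bar> / h * (1 / \<epsilon>)) powr (1 / real n)"
      by (intro powr_mono2) auto
    moreover have "(real (Suc J) ^ n) powr (1 / real n) = real (Suc J)"
      using n by (simp add: powr_powr flip: powr_realpow)
    moreover have "(\<bar>D\<bar> / h * (1 / \<epsilon>)) powr (1 / real n) = (\<bar>D\<bar> / h) powr (1 / real n) * \<epsilon> powr (- 1 / real n)"
    proof -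
      have "(1 / \<epsilon>) powr (1 / real n) = \<epsilon> powr (- (1 / real n))"
        using \<epsilon> by (simp add: powr_divide powr_minus_divide)
      then show ?thesis
        using h \<epsilon> by (subst powr_mult) auto
    qed
    ultimately have "real (Suc J) \<le> (\<bar>D\<bar> / h) powr (1 / real n) * \<epsilon> powr (- 1 / real n)"
      by simp
    also have "\<dots> \<le> C * \<epsilon> powr (- 1 / real n)"
      by (intro mult_right_mono) (auto simp: C_def)
    finally have "exp (real (Suc J)) \<le> exp (C * \<epsilon> powr (- 1 / real n))" by simp
    moreover have "(2::real) ^ Suc J \<le> exp 1 ^ Suc J"
      using exp_ge_add_one_self[of 1] by (intro power_mono) auto
    then have "2 ^ Suc J \<le> exp (real (Suc J))"
      by (simp only: exp_of_nat_mult[symmetric] mult_1_right)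
    ultimately show ?thesis using J(2) by linarith
  qed
  have time: "max_existence_time p (\<lambda>x. of_real \<epsilon> * f x) \<le> ennreal (exp (C * \<epsilon> powr (- 1 / real n)))"
    if "0 < \<epsilon>" for \<epsilon>
    unfolding max_existence_time_def
    by (intro SUP_least ennreal_leI) (use bound[OF that] in blast)
  have "\<not> global_weak_solution p (\<lambda>x. of_real \<epsilon> * f x) u" if "0 < \<epsilon>" for \<epsilon> u
    using time[OF that] by (auto simp: global_weak_solution_def top_unique)
  with time C show ?thesis
    unfolding n_def by (intro exI[of _ 1] exI[of _ C]) auto
qed

end
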